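(* Every outerplanar graph $G$ has an equitable $t$-tree-coloring for every integer $t\ge 2$; that is, $va^{\equiv}_{\infty,\infty}(G)=2$ if $G$ is not a forest and $va^{\equiv}_{\infty,\infty}(G)=1$ otherwise.
   Context: A graph is outerplanar if it can be drawn in the plane without crossings so that all vertices lie on the outer face. A $t$-coloring of $G$ is a map $f:V(G)\to\{1,\dots,t\}$ (not necessarily surjective) with color classes $V_i=f^{-1}(i)$; it is equitable if $||V_i|-|V_j||\le 1$ for all $i,j$. An equitable $t$-tree-coloring is an equitable $t$-coloring in which every color class induces a forest. $va^{\equiv}_{\infty,\infty}(G)$ is the smallest positive integer $t$ such that $G$ has an equitable $t'$-tree-coloring for every integer $t'\ge t$. *)

theory Defs
  imports "HOL-Analysis.Analysis"
begin

text \<open>A finite simple graph is given by its vertex set \<open>V\<close> and its set \<open>E\<close> of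
  two-element edges.\<close>

definition simple_graph :: "'a set \<Rightarrow> 'a set set \<Rightarrow> bool" where
  "simple_graph V E \<longleftrightarrow> finite V \<and> (\<forall>e\<in>E. e \<subseteq> V \<and> card e = 2)"

text \<open>A cycle is listed by its vertices in cyclic order, without repeating the first one.\<close>

definition is_cycle :: "'a set \<Rightarrow> 'a set set \<Rightarrow> 'a list \<Rightarrow> bool" where
  "is_cycle V E vs \<longleftrightarrow> set vs \<subseteq> V \<and> distinct vs \<and> 3 \<le> length vs \<and>
     (\<forall>i<length vs. {vs ! i, vs ! (Suc i mod length vs)} \<in> E)"

definition forest :: "'a set \<Rightarrow> 'a set set \<Rightarrow> bool" where
  "forest V E \<longleftrightarrow> (\<nexists>vs. is_cycle V E vs)"

definition induced_edges :: "'a set set \<Rightarrow> 'a set \<Rightarrow> 'a set set" where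
  "induced_edges E W = {e \<in> E. e \<subseteq> W}"

text \<open>A drawing without crossings: vertices are distinct points, edges are (not necessarily
  polygonal) arcs joining their end vertices, no edge passes through a further vertex, and two
  edges meet at most in common end vertices.\<close>

definition plane_drawing ::
  "'a set \<Rightarrow> 'a set set \<Rightarrow> ('a \<Rightarrow> complex) \<Rightarrow> ('a set \<Rightarrow> real \<Rightarrow> complex) \<Rightarrow> bool" where
  "plane_drawing V E p \<gamma> \<longleftrightarrow>
     inj_on p V \<and>
     (\<forall>e\<in>E. arc (\<gamma> e) \<and> {pathstart (\<gamma> e), pathfinish (\<gamma> e)} = p ` e \<and>
        path_image (\<gamma> e) \<inter> p ` V = p ` e) \<and>
     (\<forall>e\<in>E. \<forall>e'\<in>E. e \<noteq> e' \<longrightarrow> path_image (\<gamma> e) \<inter> path_image (\<gamma> e') = p ` (e \<inter> e'))"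

definition drawing_points ::
  "'a set \<Rightarrow> 'a set set \<Rightarrow> ('a \<Rightarrow> complex) \<Rightarrow> ('a set \<Rightarrow> real \<Rightarrow> complex) \<Rightarrow> complex set" where
  "drawing_points V E p \<gamma> = p ` V \<union> (\<Union>e\<in>E. path_image (\<gamma> e))"

text \<open>The drawing of a finite graph is bounded, so the complement has exactly one unbounded
  component, the outer face; this is \<^const>\<open>outside\<close>. Faces are open and disjoint from the
  drawing, so a vertex lies on a face when it belongs to the boundary of that face.\<close>

definition outerplanar :: "'a set \<Rightarrow> 'a set set \<Rightarrow> bool" where
  "outerplanar V E \<longleftrightarrow>
     (\<exists>p \<gamma>. plane_drawing V E p \<gamma> \<and> p ` V \<subseteq> frontier (outside (drawing_points V E p \<gamma>)))"

definition color_class :: "'a set \<Rightarrow> ('a \<Rightarrow> nat) \<Rightarrow> nat \<Rightarrow> 'a set" where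
  "color_class V f i = {v \<in> V. f v = i}"

definition coloring :: "'a set \<Rightarrow> nat \<Rightarrow> ('a \<Rightarrow> nat) \<Rightarrow> bool" where
  "coloring V t f \<longleftrightarrow> f ` V \<subseteq> {1..t}"

definition equitable :: "'a set \<Rightarrow> nat \<Rightarrow> ('a \<Rightarrow> nat) \<Rightarrow> bool" where
  "equitable V t f \<longleftrightarrow>
     (\<forall>i\<in>{1..t}. \<forall>j\<in>{1..t}. \<bar>int (card (color_class V f i)) - int (card (color_class V f j))\<bar> \<le> 1)"

definition equitable_tree_coloring :: "'a set \<Rightarrow> 'a set set \<Rightarrow> nat \<Rightarrow> ('a \<Rightarrow> nat) \<Rightarrow> bool" where
  "equitable_tree_coloring V E t f \<longleftrightarrow>
     coloring V t f \<and> equitable V t f \<and>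
     (\<forall>i\<in>{1..t}. forest (color_class V f i) (induced_edges E (color_class V f i)))"

text \<open>For a finite graph the minimum exists: every \<open>t \<ge> max 1 (card V)\<close> has the property, by
  giving distinct colors to all vertices.\<close>

definition va_equiv :: "'a set \<Rightarrow> 'a set set \<Rightarrow> nat" where
  "va_equiv V E = (LEAST t. 1 \<le> t \<and> (\<forall>t'\<ge>t. \<exists>f. equitable_tree_coloring V E t' f))"

end

theory Submission
  imports Defs
begin

text \<open>
  In a plane drawing of three internally disjoint paths with common ends, one path runs inside the
  cycle formed by the other two. If all vertices are on the outer face, such a path has no inner
  vertex. This excludes subdivisions of \<open>K\<^bsub>2,3\<^esub>\<close> and \<open>K\<^sub>4\<close>; the rest of the argument uses
  nothing else about the drawing.

  A graph without these subdivisions has a vertex of degree at most 1 or an edge \<open>xy\<close> with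
  \<open>deg x = 2\<close> and \<open>deg y \<le> 4\<close>, by a longest-path argument. Hence one can remove a set \<open>S\<close> of \<open>t\<close>
  vertices each having at most 3 neighbours outside \<open>S\<close>, and one of them at most 1. Color the rest
  by induction. A vertex of \<open>S\<close> must avoid the colors that appear twice among its neighbours outside
  \<open>S\<close>; there is at most one, and for the exceptional vertex none. So the \<open>t\<close> colors can be
  distributed bijectively over \<open>S\<close>, and every color class gains a vertex of degree at most 1.
\<close>

subsection \<open>Theta curves\<close>

definition arc_between :: "complex set \<Rightarrow> complex \<Rightarrow> complex \<Rightarrow> bool" where
  "arc_between A a b \<longleftrightarrow> (\<exists>g. arc g \<and> path_image g = A \<and> pathstart g = a \<and> pathfinish g = b)"

lemma arc_between_commute: "arc_between A a b \<Longrightarrow> arc_between A b a"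
  unfolding arc_between_def
  by (metis arc_reversepath path_image_reversepath pathfinish_reversepath pathstart_reversepath)

lemma compact_arc_between: "arc_between A a b \<Longrightarrow> compact A"
  unfolding arc_between_def using compact_arc_image by blast

lemma connected_arc_between: "arc_between A a b \<Longrightarrow> connected A"
  unfolding arc_between_def using connected_arc_image by blast

lemma connected_arc_between_endless: "arc_between A a b \<Longrightarrow> connected (A - {a, b})"
  unfolding arc_between_def using connected_simple_path_endless arc_imp_simple_path by blast

lemma arc_between_endless_nonempty: "arc_between A a b \<Longrightarrow> A - {a, b} \<noteq> {}"
  unfolding arc_between_def using nonempty_simple_path_endless arc_imp_simple_path by blast

lemma arc_between_join:
  assumes "arc_between A a b" "arc_between B b c" "A \<inter> B = {b}"
  shows "arc_between (A \<union> B) a c"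
proof -
  obtain g h where g: "arc g" "path_image g = A" "pathstart g = a" "pathfinish g = b"
    and h: "arc h" "path_image h = B" "pathstart h = b" "pathfinish h = c"
    using assms unfolding arc_between_def by blast
  have "arc (g +++ h)"
    using g h assms by (intro arc_join) auto
  then show ?thesis
    unfolding arc_between_def using g h by (intro exI[of _ "g +++ h"]) (auto simp: path_image_join)
qed

lemma Jordan_two_arcs:
  assumes "arc_between A a b" "arc_between B a b" "A \<inter> B = {a, b}"
  shows "connected (inside (A \<union> B))" "frontier (inside (A \<union> B)) = A \<union> B"
    "frontier (outside (A \<union> B)) = A \<union> B"
proof -
  obtain g h where g: "arc g" "path_image g = A" "pathstart g = a" "pathfinish g = b"
    and h: "arc h" "path_image h = B" "pathstart h = b" "pathfinish h = a"
    using assms(1) arc_between_commute[OF assms(2)] unfolding arc_between_def by blast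
  have "simple_path (g +++ h)"
    using g h assms by (intro simple_path_join_loop) auto
  moreover have "path_image (g +++ h) = A \<union> B" "pathfinish (g +++ h) = pathstart (g +++ h)"
    using g h by (auto simp: path_image_join)
  ultimately show "connected (inside (A \<union> B))"
    "frontier (inside (A \<union> B)) = A \<union> B" "frontier (outside (A \<union> B)) = A \<union> B"
    using Jordan_inside_outside[of "g +++ h"] by auto
qed

lemma connected_subset_inside:
  assumes "connected S" "S \<inter> J = {}" "S \<inter> inside J \<noteq> {}"
  shows "S \<subseteq> inside J"
  using inside_outside_intersect_connected[OF assms(1), of J] assms(2,3) inside_Un_outside[of J]
  by blast

lemma frontier_outside_Int_inside:
  fixes K :: "'a :: real_normed_vector set"
  assumes "closed K" "K \<inter> outside J = {}"
  shows "frontier (outside J) \<inter> inside K = {}"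
proof -
  have "outside J \<subseteq> outside (J \<union> K)"
    using outside_Un_outside_Un[of K J "{}"] assms(2) by simp
  also have "\<dots> \<subseteq> outside K" by (intro outside_mono) simp
  finally have "inside K \<inter> outside J = {}" using inside_Int_outside by blast
  then have "inside K \<inter> closure (outside J) = {}"
    using open_inside[OF assms(1)] by (simp add: open_Int_closure_eq_empty)
  then show ?thesis by (auto simp: frontier_def)
qed

lemma boundary_Int_inside:
  fixes K :: "'a :: real_normed_vector set"
  assumes "frontier (outside J) = J" "closed K" "K \<subseteq> J \<union> inside J"
  shows "J \<inter> inside K = {}"
proof -
  have "K \<subseteq> - outside J" using assms(3) by (simp only: union_with_inside)
  then have "K \<inter> outside J = {}" by (simp only: disjoint_eq_subset_Compl)
  then show ?thesis using frontier_outside_Int_inside[OF assms(2)] assms(1) by metis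
qed

lemma outside_Int_outside_subset:
  fixes S T :: "complex set"
  assumes "compact S" "compact T" "connected (S \<inter> T)"
  shows "outside S \<inter> outside T \<subseteq> outside (S \<union> T)"
proof
  fix x assume x: "x \<in> outside S \<inter> outside T"
  have bounded: "bounded S" "bounded T" using assms compact_imp_bounded by blast+
  then obtain y where y: "y \<in> outside (S \<union> T)"
    using outside_bounded_nonempty[OF bounded_Un[THEN iffD2]] by blast
  then have "y \<in> outside S \<inter> outside T"
    using outside_mono[of S "S \<union> T"] outside_mono[of T "S \<union> T"] by blast
  moreover have "connected_component (- R) y x"
    if "y \<in> outside R" "x \<in> outside R" "bounded R" for R :: "complex set"
  proof -
    have "connected (outside R)" using connected_outside[OF that(3)] by simp
    moreover have "outside R \<subseteq> - R" using outside_no_overlap[of R] by blast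
    ultimately show ?thesis unfolding connected_component_def using that(1,2) by blast
  qed
  ultimately have "connected_component (- S) y x" "connected_component (- T) y x"
    using x bounded by blast+
  then have "connected_component (- (S \<union> T)) y x"
    using Janiszewski[OF assms(1) compact_imp_closed[OF assms(2)] assms(3)] by blast
  then show "x \<in> outside (S \<union> T)" using outside_same_component y by blast
qed

definition theta_curve ::
  "complex set \<Rightarrow> complex set \<Rightarrow> complex set \<Rightarrow> complex \<Rightarrow> complex \<Rightarrow> bool" where
  "theta_curve A B C a b \<longleftrightarrow>
     arc_between A a b \<and> arc_between B a b \<and> arc_between C a b \<and>
     A \<inter> B = {a, b} \<and> A \<inter> C = {a, b} \<and> B \<inter> C = {a, b}"

lemma theta_curve_permute:
  assumes "theta_curve A B C a b"
  shows "theta_curve A C B a b" "theta_curve B C A a b"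
  using assms by (auto simp: theta_curve_def)

lemma theta_curve_Jordan:
  assumes "theta_curve A B C a b"
  shows "connected (inside (A \<union> B))" "frontier (inside (A \<union> B)) = A \<union> B"
    "frontier (outside (A \<union> B)) = A \<union> B"
  using assms Jordan_two_arcs[of A a b B] by (auto simp: theta_curve_def)

lemma theta_curve_arc_inside_or_disjoint:
  assumes "theta_curve A B C a b"
  shows "C - {a, b} \<subseteq> inside (A \<union> B) \<or> C \<inter> inside (A \<union> B) = {}"
proof -
  have "(C - {a, b}) \<inter> (A \<union> B) = {}" "{a, b} \<subseteq> A \<union> B"
    using assms by (auto simp: theta_curve_def)
  moreover have "connected (C - {a, b})"
    using assms connected_arc_between_endless by (auto simp: theta_curve_def)
  ultimately show ?thesis
    using connected_subset_inside[of "C - {a, b}" "A \<union> B"] inside_no_overlap[of "A \<union> B"] by blast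
qed

text \<open>Janiszewski's theorem applies to \<open>A \<union> B\<close> and \<open>B \<union> C\<close>, since they meet in the connected set \<open>B\<close>.\<close>

lemma theta_curve_inside_subset:
  assumes "theta_curve A B C a b"
  shows "inside (A \<union> C) \<subseteq> inside (A \<union> B) \<union> inside (B \<union> C) \<union> B"
proof
  fix x assume x: "x \<in> inside (A \<union> C)"
  have compact: "compact (A \<union> B)" "compact (B \<union> C)"
    using assms compact_arc_between by (auto simp: theta_curve_def)
  have "(A \<union> B) \<inter> (B \<union> C) = B" using assms by (auto simp: theta_curve_def)
  then have connected: "connected ((A \<union> B) \<inter> (B \<union> C))"
    using assms connected_arc_between by (auto simp: theta_curve_def)
  have "A \<union> C \<subseteq> (A \<union> B) \<union> (B \<union> C)" by blast
  then have "outside (A \<union> B) \<inter> outside (B \<union> C) \<subseteq> outside (A \<union> C)"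
    using outside_Int_outside_subset[OF compact connected] outside_mono by (meson order_trans)
  then have "x \<notin> outside (A \<union> B) \<inter> outside (B \<union> C)"
    using x inside_Int_outside[of "A \<union> C"] by blast
  moreover have "x \<notin> A \<union> C" using x inside_no_overlap[of "A \<union> C"] by blast
  ultimately show "x \<in> inside (A \<union> B) \<union> inside (B \<union> C) \<union> B"
    by (auto simp: outside_inside)
qed

text \<open>Otherwise no arc meets the region bounded by the other two. Near a point of \<open>A\<close>, the region of
  \<open>A \<union> C\<close> then contains points of the region of \<open>A \<union> B\<close>, so the two regions and hence their
  boundaries coincide.\<close>

lemma theta_curve_inside:
  assumes "theta_curve A B C a b"
  shows "A - {a, b} \<subseteq> inside (B \<union> C) \<or> B - {a, b} \<subseteq> inside (A \<union> C) \<or> C - {a, b} \<subseteq> inside (A \<union> B)"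
proof (rule ccontr)
  assume not_inside: "\<not> ?thesis"
  note ACB = theta_curve_permute(1)[OF assms] and BCA = theta_curve_permute(2)[OF assms]
  have disjoint: "A \<inter> inside (B \<union> C) = {}" "B \<inter> inside (A \<union> C) = {}" "C \<inter> inside (A \<union> B) = {}"
    using not_inside theta_curve_arc_inside_or_disjoint[OF BCA]
      theta_curve_arc_inside_or_disjoint[OF ACB] theta_curve_arc_inside_or_disjoint[OF assms] by blast+
  obtain q where q: "q \<in> A" "q \<notin> B \<union> C"
    using assms arc_between_endless_nonempty[of A a b] by (auto simp: theta_curve_def)
  have "q \<in> outside (B \<union> C)"
    using q disjoint(1) by (auto simp: outside_inside)
  moreover have "open (outside (B \<union> C))"
    using assms compact_arc_between
    by (intro open_outside closed_Un compact_imp_closed) (auto simp: theta_curve_def)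
  moreover have "q \<in> closure (inside (A \<union> C))"
    using theta_curve_Jordan(2)[OF ACB] q by (auto simp: frontier_def)
  ultimately obtain x where x: "x \<in> inside (A \<union> C)" "x \<in> outside (B \<union> C)"
    by (meson disjoint_iff open_Int_closure_eq_empty)
  then have "x \<in> inside (A \<union> B)"
    using theta_curve_inside_subset[OF assms] disjoint(2) inside_Int_outside[of "B \<union> C"] by blast
  then have "inside (A \<union> B) \<subseteq> inside (A \<union> C)" "inside (A \<union> C) \<subseteq> inside (A \<union> B)"
    using connected_subset_inside[OF theta_curve_Jordan(1)[OF assms], of "A \<union> C"]
      connected_subset_inside[OF theta_curve_Jordan(1)[OF ACB], of "A \<union> B"]
      disjoint(2,3) inside_no_overlap[of "A \<union> B"] inside_no_overlap[of "A \<union> C"] x(1) by blast+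
  then have "A \<union> B = A \<union> C"
    using theta_curve_Jordan(2)[OF assms] theta_curve_Jordan(2)[OF ACB] by (metis subset_antisym)
  moreover have "B - {a, b} \<noteq> {}"
    using assms arc_between_endless_nonempty[of B] by (auto simp: theta_curve_def)
  ultimately show False using assms unfolding theta_curve_def by blast
qed

subsection \<open>Paths and subdivisions\<close>

definition verts :: "'a set set \<Rightarrow> 'a set" where
  "verts F = \<Union>F"

lemma verts_simps [simp]:
  "verts (insert e F) = e \<union> verts F" "verts {} = {}" "verts (F \<union> F') = verts F \<union> verts F'"
  by (auto simp: verts_def)

lemma subset_verts: "e \<in> F \<Longrightarrow> e \<subseteq> verts F"
  by (auto simp: verts_def)

text \<open>Paths are represented by their sets of edges.\<close>

inductive graph_path :: "'a set set \<Rightarrow> 'a \<Rightarrow> 'a \<Rightarrow> 'a set set \<Rightarrow> bool" for E where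
  edge: "{x, y} \<in> E \<Longrightarrow> x \<noteq> y \<Longrightarrow> graph_path E x y {{x, y}}"
| step: "{x, z} \<in> E \<Longrightarrow> graph_path E z y F \<Longrightarrow> x \<notin> verts F \<Longrightarrow> graph_path E x y (insert {x, z} F)"

lemma graph_path_ends:
  assumes "graph_path E x y F"
  shows "x \<in> verts F" "y \<in> verts F" "x \<noteq> y"
  using assms by (induction rule: graph_path.induct) auto

lemma graph_path_edges: "graph_path E x y F \<Longrightarrow> F \<subseteq> E"
  by (induction rule: graph_path.induct) auto

lemma graph_path_card_edge: "graph_path E x y F \<Longrightarrow> e \<in> F \<Longrightarrow> card e = 2"
proof (induction rule: graph_path.induct)
  case (step x z y F)
  then show ?case using graph_path_ends(1)[OF step(2)] by (cases "x = z") auto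
qed auto

lemma graph_path_mono: "graph_path E x y F \<Longrightarrow> E \<subseteq> E' \<Longrightarrow> graph_path E' x y F"
  by (induction rule: graph_path.induct) (auto intro: graph_path.intros)

lemma graph_path_direct_edge:
  assumes "graph_path E x y F" "{x, y} \<in> F"
  shows "verts F = {x, y}"
  using assms
proof cases
  case (step z F')
  then have "{x, y} \<notin> F'" using subset_verts[of "{x, y}" F'] by auto
  then have "y = z" using assms(2) step(1) by (auto simp: doubleton_eq_iff)
  then show ?thesis using graph_path_ends(3)[OF step(3)] by blast
qed auto

lemma graph_path_append:
  assumes "graph_path E x y F" "graph_path E y z F'" "verts F \<inter> verts F' = {y}"
  shows "graph_path E x z (F \<union> F')"
  using assms
proof (induction rule: graph_path.induct)
  case (edge x y)
  then show ?case using graph_path.step[of x y E z F'] by auto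
next
  case (step x u y F)
  have "y \<in> verts F" "u \<in> verts F" using graph_path_ends[OF step(2)] by auto
  then have "verts F \<inter> verts F' = {y}" "x \<notin> verts (F \<union> F')"
    using step by auto
  then show ?case
    using step graph_path.step[of x u E z "F \<union> F'"] by simp
qed

lemma graph_path_reverse: "graph_path E x y F \<Longrightarrow> graph_path E y x F"
proof (induction rule: graph_path.induct)
  case (edge x y)
  then show ?case using graph_path.edge[of y x E] by (simp add: insert_commute)
next
  case (step x z y F)
  have "graph_path E z x {{x, z}}"
    using step graph_path.edge[of z x E] graph_path_ends[OF step(2)] by (auto simp: insert_commute)
  then have "graph_path E y x (F \<union> {{x, z}})"
    using step graph_path_ends[OF step(2)] by (intro graph_path_append) auto
  then show ?case by simp
qed

lemma graph_path_split:
  assumes "graph_path E x y F" "c \<in> verts F" "c \<noteq> x" "c \<noteq> y"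
  obtains F1 F2 where "F = F1 \<union> F2" "graph_path E x c F1" "graph_path E c y F2"
    "verts F1 \<inter> verts F2 = {c}"
proof -
  have "\<exists>F1 F2. F = F1 \<union> F2 \<and> graph_path E x c F1 \<and> graph_path E c y F2 \<and> verts F1 \<inter> verts F2 = {c}"
    using assms
  proof (induction rule: graph_path.induct)
    case (step x z y F)
    have z: "z \<in> verts F" using graph_path_ends(1)[OF step.hyps(2)] .
    show ?case
    proof (cases "c = z")
      case True
      have "graph_path E x z {{x, z}}" using step.hyps z by (intro graph_path.edge) auto
      moreover have "verts {{x, z}} \<inter> verts F = {z}" using step.hyps(3) z by simp
      ultimately show ?thesis
        using True step.hyps(2) by (intro exI[of _ "{{x, z}}"] exI[of _ F]) simp
    next
      case False
      have "c \<in> verts F" using step.prems False by simp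
      then obtain F1 F2 where F: "F = F1 \<union> F2" "graph_path E z c F1" "graph_path E c y F2"
        "verts F1 \<inter> verts F2 = {c}"
        using step.IH[OF _ False step.prems(3)] by blast
      then have "graph_path E x c (insert {x, z} F1)"
        using step.hyps by (intro graph_path.step) auto
      moreover have "insert {x, z} F = insert {x, z} F1 \<union> F2" using F(1) by simp
      moreover have "verts (insert {x, z} F1) \<inter> verts F2 = {c}"
        using F step.hyps(3) graph_path_ends(1)[OF F(2)] False by auto
      ultimately show ?thesis using F(3) by blast
    qed
  qed auto
  then show thesis using that by blast
qed

lemma graph_path_two_edges:
  assumes "{x, z} \<in> E" "{z, y} \<in> E" "x \<noteq> y" "x \<noteq> z" "z \<noteq> y"
  shows "graph_path E x y {{x, z}, {z, y}}"
  using assms by (intro graph_path.step graph_path.edge) auto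

lemma graph_path_edge_disjoint:
  assumes "graph_path E x y F" "graph_path E x y F'" "verts F \<inter> verts F' = {x, y}" "verts F \<noteq> {x, y}"
  shows "F \<inter> F' = {}"
proof (rule ccontr)
  assume "F \<inter> F' \<noteq> {}"
  then obtain e where e: "e \<in> F" "e \<in> F'" by blast
  then have "e \<subseteq> {x, y}" using assms(3) subset_verts[of e] by blast
  moreover have "card e = 2" using graph_path_card_edge[OF assms(1) e(1)] .
  ultimately have "e = {x, y}"
    using graph_path_ends(3)[OF assms(1)] by (intro card_seteq) auto
  then show False using graph_path_direct_edge[OF assms(1)] e(1) assms(4) by blast
qed

definition theta :: "'a set set \<Rightarrow> 'a \<Rightarrow> 'a \<Rightarrow> 'a set set \<Rightarrow> 'a set set \<Rightarrow> 'a set set \<Rightarrow> bool" where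
  "theta E x y F1 F2 F3 \<longleftrightarrow>
     graph_path E x y F1 \<and> graph_path E x y F2 \<and> graph_path E x y F3 \<and>
     verts F1 \<inter> verts F2 = {x, y} \<and> verts F1 \<inter> verts F3 = {x, y} \<and> verts F2 \<inter> verts F3 = {x, y}"

lemma theta_edge_disjoint:
  assumes "theta E x y F1 F2 F3" "verts F1 \<noteq> {x, y}" "verts F2 \<noteq> {x, y}"
  shows "F1 \<inter> F2 = {}" "F1 \<inter> F3 = {}" "F2 \<inter> F3 = {}"
proof -
  have path: "graph_path E x y F1" "graph_path E x y F2" "graph_path E x y F3"
    and meet: "verts F1 \<inter> verts F2 = {x, y}" "verts F1 \<inter> verts F3 = {x, y}"
      "verts F2 \<inter> verts F3 = {x, y}"
    using assms(1) by (simp_all add: theta_def)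
  show "F1 \<inter> F2 = {}" "F1 \<inter> F3 = {}" "F2 \<inter> F3 = {}"
    using graph_path_edge_disjoint[OF path(1,2) meet(1)] graph_path_edge_disjoint[OF path(1,3) meet(2)]
      graph_path_edge_disjoint[OF path(2,3) meet(3)] assms(2,3) by simp_all
qed

text \<open>The subdivisions of \<open>K\<^bsub>2,3\<^esub>\<close> are the thetas whose three paths all have inner vertices.\<close>

definition K23_subdivision_free :: "'a set set \<Rightarrow> bool" where
  "K23_subdivision_free E \<longleftrightarrow>
     (\<forall>x y F1 F2 F3. theta E x y F1 F2 F3 \<longrightarrow>
       verts F1 = {x, y} \<or> verts F2 = {x, y} \<or> verts F3 = {x, y})"

text \<open>A subdivision of \<open>K\<^sub>4\<close> is a theta together with a path between inner vertices of two of its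
  paths; \<open>x\<close>, \<open>y\<close>, \<open>c\<close> and \<open>d\<close> are the branch vertices.\<close>

definition K4_subdivision ::
  "'a set set \<Rightarrow> 'a \<Rightarrow> 'a \<Rightarrow> 'a \<Rightarrow> 'a \<Rightarrow> 'a set set \<Rightarrow> 'a set set \<Rightarrow> 'a set set \<Rightarrow> 'a set set \<Rightarrow> bool" where
  "K4_subdivision E x y c d F1 F2 F3 F \<longleftrightarrow>
     theta E x y F1 F2 F3 \<and> graph_path E c d F \<and>
     verts F \<inter> verts F1 = {c} \<and> verts F \<inter> verts F2 = {d} \<and> verts F \<inter> verts F3 = {}"

definition K4_subdivision_free :: "'a set set \<Rightarrow> bool" where
  "K4_subdivision_free E \<longleftrightarrow> (\<nexists>x y c d F1 F2 F3 F. K4_subdivision E x y c d F1 F2 F3 F)"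

lemma K23_subdivision_free_mono:
  assumes "K23_subdivision_free E" "E' \<subseteq> E"
  shows "K23_subdivision_free E'"
proof -
  have "theta E x y F1 F2 F3" if "theta E' x y F1 F2 F3" for x y F1 F2 F3
    using that graph_path_mono[OF _ assms(2)] by (auto simp: theta_def)
  then show ?thesis using assms(1) unfolding K23_subdivision_free_def by blast
qed

lemma K4_subdivision_free_mono:
  assumes "K4_subdivision_free E" "E' \<subseteq> E"
  shows "K4_subdivision_free E'"
proof -
  have "K4_subdivision E x y c d F1 F2 F3 F"
    if "K4_subdivision E' x y c d F1 F2 F3 F" for x y c d F1 F2 F3 F
    using that graph_path_mono[OF _ assms(2)] by (auto simp: K4_subdivision_def theta_def)
  then show ?thesis using assms(1) unfolding K4_subdivision_free_def by blast
qed

lemma K4_subdivision_inner_vertices: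
  assumes "K4_subdivision E x y c d F1 F2 F3 F"
  shows "c \<in> verts F1 - {x, y}" "d \<in> verts F2 - {x, y}" "verts F1 \<noteq> {x, y}" "verts F2 \<noteq> {x, y}"
proof -
  have "x \<in> verts F3" "y \<in> verts F3"
    using assms graph_path_ends[of E x y F3] by (auto simp: K4_subdivision_def theta_def)
  moreover have "verts F \<inter> verts F1 = {c}" "verts F \<inter> verts F2 = {d}" "verts F \<inter> verts F3 = {}"
    using assms by (simp_all add: K4_subdivision_def)
  ultimately show "c \<in> verts F1 - {x, y}" "d \<in> verts F2 - {x, y}" by blast+
  then show "verts F1 \<noteq> {x, y}" "verts F2 \<noteq> {x, y}" by (metis DiffE)+
qed

lemma K4_subdivision_edge_disjoint:
  assumes "K4_subdivision E x y c d F1 F2 F3 F"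
  shows "F1 \<inter> F2 = {}" "F1 \<inter> F3 = {}" "F2 \<inter> F3 = {}" "F \<inter> F1 = {}" "F \<inter> F2 = {}" "F \<inter> F3 = {}"
proof -
  have theta: "theta E x y F1 F2 F3" and path: "graph_path E c d F"
    and meet: "verts F \<inter> verts F1 = {c}" "verts F \<inter> verts F2 = {d}" "verts F \<inter> verts F3 = {}"
    using assms by (simp_all add: K4_subdivision_def)
  show "F1 \<inter> F2 = {}" "F1 \<inter> F3 = {}" "F2 \<inter> F3 = {}"
    using theta_edge_disjoint[OF theta K4_subdivision_inner_vertices(3,4)[OF assms]] .
  have "F \<inter> G = {}" if "verts F \<inter> verts G \<subseteq> {z}" for G z
  proof (rule ccontr)
    assume "F \<inter> G \<noteq> {}"
    then obtain e where e: "e \<in> F" "e \<in> G" by blast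
    then have "e \<subseteq> {z}" using that subset_verts[of e] by blast
    then have "card e \<le> 1" using card_mono[of "{z}" e] by simp
    then show False using graph_path_card_edge[OF path e(1)] by simp
  qed
  then show "F \<inter> F1 = {}" "F \<inter> F2 = {}" "F \<inter> F3 = {}"
    using meet by (metis empty_subsetI order_refl)+
qed

definition K4_branch_paths ::
  "'a set set \<Rightarrow> 'a \<Rightarrow> 'a \<Rightarrow> 'a \<Rightarrow> 'a \<Rightarrow> 'a set set \<Rightarrow> 'a set set \<Rightarrow> 'a set set \<Rightarrow> 'a set set \<Rightarrow>
    'a set set \<Rightarrow> 'a set set \<Rightarrow> bool" where
  "K4_branch_paths E x y c d A1 A2 B1 B2 F3 F \<longleftrightarrow>
     graph_path E x c A1 \<and> graph_path E c y A2 \<and> graph_path E x d B1 \<and> graph_path E d y B2 \<and>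
     graph_path E x y F3 \<and> graph_path E c d F \<and>
     verts A1 \<inter> verts A2 = {c} \<and> verts B1 \<inter> verts B2 = {d} \<and>
     verts A1 \<inter> verts B1 = {x} \<and> verts A2 \<inter> verts B2 = {y} \<and>
     verts A1 \<inter> verts B2 = {} \<and> verts A2 \<inter> verts B1 = {} \<and>
     verts F3 \<inter> verts A1 = {x} \<and> verts F3 \<inter> verts A2 = {y} \<and>
     verts F3 \<inter> verts B1 = {x} \<and> verts F3 \<inter> verts B2 = {y} \<and>
     verts F \<inter> verts A1 = {c} \<and> verts F \<inter> verts A2 = {c} \<and>
     verts F \<inter> verts B1 = {d} \<and> verts F \<inter> verts B2 = {d} \<and> verts F \<inter> verts F3 = {}"

lemma K4_subdivision_split:
  assumes "K4_subdivision E x y c d F1 F2 F3 F"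
  obtains A1 A2 B1 B2 where "F1 = A1 \<union> A2" "F2 = B1 \<union> B2"
    "K4_branch_paths E x y c d A1 A2 B1 B2 F3 F"
proof -
  have path: "graph_path E x y F1" "graph_path E x y F2" "graph_path E x y F3" "graph_path E c d F"
    and meet: "verts F1 \<inter> verts F2 = {x, y}" "verts F1 \<inter> verts F3 = {x, y}"
      "verts F2 \<inter> verts F3 = {x, y}"
      "verts F \<inter> verts F1 = {c}" "verts F \<inter> verts F2 = {d}" "verts F \<inter> verts F3 = {}"
    using assms by (simp_all add: K4_subdivision_def theta_def)
  have inner: "c \<in> verts F1" "c \<noteq> x" "c \<noteq> y" "d \<in> verts F2" "d \<noteq> x" "d \<noteq> y"
    using K4_subdivision_inner_vertices(1,2)[OF assms] by auto
  obtain A1 A2 where F1: "F1 = A1 \<union> A2" "graph_path E x c A1" "graph_path E c y A2"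
      "verts A1 \<inter> verts A2 = {c}"
    using graph_path_split[OF path(1) inner(1-3)] by blast
  obtain B1 B2 where F2: "F2 = B1 \<union> B2" "graph_path E x d B1" "graph_path E d y B2"
      "verts B1 \<inter> verts B2 = {d}"
    using graph_path_split[OF path(2) inner(4-6)] by blast
  have ends: "x \<in> verts A1" "c \<in> verts A1" "c \<in> verts A2" "y \<in> verts A2"
    "x \<in> verts B1" "d \<in> verts B1" "d \<in> verts B2" "y \<in> verts B2"
    using graph_path_ends F1(2,3) F2(2,3) by metis+
  then have not_ends: "x \<notin> verts A2" "y \<notin> verts A1" "x \<notin> verts B2" "y \<notin> verts B1"
    using F1(4) F2(4) inner by auto
  have verts_eq: "verts F1 = verts A1 \<union> verts A2" "verts F2 = verts B1 \<union> verts B2"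
    using F1(1) F2(1) by simp_all
  have "verts A1 \<inter> verts B1 = {x}" "verts A2 \<inter> verts B2 = {y}"
    "verts A1 \<inter> verts B2 = {}" "verts A2 \<inter> verts B1 = {}"
    using meet(1) ends not_ends unfolding verts_eq by fast+
  moreover have "verts F3 \<inter> verts A1 = {x}" "verts F3 \<inter> verts A2 = {y}"
    using meet(2) ends not_ends unfolding verts_eq by fast+
  moreover have "verts F3 \<inter> verts B1 = {x}" "verts F3 \<inter> verts B2 = {y}"
    using meet(3) ends not_ends unfolding verts_eq by fast+
  moreover have "verts F \<inter> verts A1 = {c}" "verts F \<inter> verts A2 = {c}"
    using meet(4) ends unfolding verts_eq by fast+
  moreover have "verts F \<inter> verts B1 = {d}" "verts F \<inter> verts B2 = {d}"
    using meet(5) ends unfolding verts_eq by fast+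
  ultimately have "K4_branch_paths E x y c d A1 A2 B1 B2 F3 F"
    by (simp only: K4_branch_paths_def F1(2-4) F2(2-4) path(3,4) meet(6))
  then show thesis by (rule that[OF F1(1) F2(1)])
qed

definition subdivision :: "'a set set \<Rightarrow> 'a set set \<Rightarrow> ('a set \<Rightarrow> 'a set set) \<Rightarrow> bool" where
  "subdivision E' E P \<longleftrightarrow>
     (\<forall>x y. {x, y} \<in> E' \<longrightarrow> graph_path E x y (P {x, y})) \<and>
     (\<forall>e\<in>E'. \<forall>e'\<in>E'. e \<noteq> e' \<longrightarrow> verts (P e) \<inter> verts (P e') = e \<inter> e')"

lemma subdivision_edge_subset:
  assumes "subdivision E' E P" "e \<in> E'" "card e = 2"
  shows "e \<subseteq> verts (P e)"
proof -
  obtain x y where "e = {x, y}" using assms(3) by (auto simp: card_2_iff)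
  then show ?thesis
    using assms graph_path_ends[of E x y "P e"] by (auto simp: subdivision_def)
qed

lemma subdivision_Int:
  assumes "subdivision E' E P" "F \<subseteq> E'" "F' \<subseteq> E'" "F \<inter> F' = {}"
  shows "verts (\<Union>(P ` F)) \<inter> verts (\<Union>(P ` F')) = verts F \<inter> verts F'"
proof -
  have "verts (P e) \<inter> verts (P e') = e \<inter> e'" if "e \<in> F" "e' \<in> F'" for e e'
  proof -
    have "e \<in> E'" "e' \<in> E'" "e \<noteq> e'" using that assms(2-4) by auto
    then show ?thesis using assms(1) by (simp add: subdivision_def)
  qed
  then have "(\<Union>e\<in>F. \<Union>e'\<in>F'. verts (P e) \<inter> verts (P e')) = (\<Union>e\<in>F. \<Union>e'\<in>F'. e \<inter> e')"
    by (intro SUP_cong) simp_all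
  moreover have "verts (\<Union>(P ` F)) \<inter> verts (\<Union>(P ` F')) = (\<Union>e\<in>F. \<Union>e'\<in>F'. verts (P e) \<inter> verts (P e'))"
    unfolding verts_def by fast
  moreover have "(\<Union>e\<in>F. \<Union>e'\<in>F'. e \<inter> e') = verts F \<inter> verts F'" unfolding verts_def by fast
  ultimately show ?thesis by (simp only:)
qed

lemma graph_path_subdivision:
  assumes "subdivision E' E P" "graph_path E' x y F"
  shows "graph_path E x y (\<Union>(P ` F))"
  using assms(2)
proof (induction rule: graph_path.induct)
  case (edge x y)
  then show ?case using assms(1) by (simp add: subdivision_def)
next
  case (step x z y F)
  have "{{x, z}} \<inter> F = {}" using step.hyps(3) subset_verts[of "{x, z}" F] by auto
  then have "verts (P {x, z}) \<inter> verts (\<Union>(P ` F)) = {x, z} \<inter> verts F"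
    using subdivision_Int[OF assms(1), of "{{x, z}}" F] step.hyps(1) graph_path_edges[OF step.hyps(2)]
    by simp
  also have "\<dots> = {z}" using step.hyps(3) graph_path_ends(1)[OF step.hyps(2)] by simp
  finally have meet: "verts (P {x, z}) \<inter> verts (\<Union>(P ` F)) = {z}" .
  have "graph_path E x z (P {x, z})" using assms(1) step.hyps(1) by (simp add: subdivision_def)
  then have "graph_path E x y (P {x, z} \<union> \<Union>(P ` F))"
    using step.IH meet by (rule graph_path_append)
  then show ?case by simp
qed

lemma K4_subdivision_free_subdivision:
  assumes "subdivision E' E P" "K4_subdivision_free E"
  shows "K4_subdivision_free E'"
  unfolding K4_subdivision_free_def
proof safe
  fix x y c d F1 F2 F3 F assume K4: "K4_subdivision E' x y c d F1 F2 F3 F"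
  then have path: "graph_path E' x y F1" "graph_path E' x y F2" "graph_path E' x y F3"
      "graph_path E' c d F"
    and meet: "verts F1 \<inter> verts F2 = {x, y}" "verts F1 \<inter> verts F3 = {x, y}"
      "verts F2 \<inter> verts F3 = {x, y}"
      "verts F \<inter> verts F1 = {c}" "verts F \<inter> verts F2 = {d}" "verts F \<inter> verts F3 = {}"
    by (simp_all add: K4_subdivision_def theta_def)
  have "K4_subdivision E x y c d (\<Union>(P ` F1)) (\<Union>(P ` F2)) (\<Union>(P ` F3)) (\<Union>(P ` F))"
    by (simp only: K4_subdivision_def theta_def path[THEN graph_path_subdivision[OF assms(1)]]
        subdivision_Int[OF assms(1)] path[THEN graph_path_edges]
        K4_subdivision_edge_disjoint[OF K4] meet)
  then show False using assms(2) unfolding K4_subdivision_free_def by blast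
qed

subsection \<open>Outerplane drawings\<close>

locale outerplane_drawing =
  fixes V :: "'a set" and E :: "'a set set" and p :: "'a \<Rightarrow> complex" and \<gamma> :: "'a set \<Rightarrow> real \<Rightarrow> complex"
  assumes simple: "simple_graph V E"
    and plane: "plane_drawing V E p \<gamma>"
    and outer: "p ` V \<subseteq> frontier (outside (drawing_points V E p \<gamma>))"
begin

definition trace :: "'a set set \<Rightarrow> complex set" where
  "trace F = (\<Union>e\<in>F. path_image (\<gamma> e))"

lemma trace_Un [simp]: "trace (F \<union> F') = trace F \<union> trace F'"
  by (auto simp: trace_def)

lemma trace_subset_drawing: "F \<subseteq> E \<Longrightarrow> trace F \<subseteq> drawing_points V E p \<gamma>"
  by (auto simp: trace_def drawing_points_def)

lemma closed_trace:
  assumes "F \<subseteq> E"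
  shows "closed (trace F)"
proof -
  have "E \<subseteq> Pow V" "finite V" using simple by (auto simp: simple_graph_def)
  then have "finite F" using assms by (meson finite_Pow_iff finite_subset)
  moreover have "closed (path_image (\<gamma> e))" if "e \<in> F" for e
    using that assms plane closed_arc_image by (auto simp: plane_drawing_def)
  ultimately show ?thesis unfolding trace_def by (intro closed_UN) auto
qed

lemma vertices_in_trace: "F \<subseteq> E \<Longrightarrow> p ` verts F \<subseteq> trace F"
  using plane unfolding plane_drawing_def trace_def verts_def by fastforce

lemma verts_subset: "F \<subseteq> E \<Longrightarrow> verts F \<subseteq> V"
  using simple unfolding simple_graph_def verts_def by blast

lemma trace_Int:
  assumes "F \<subseteq> E" "F' \<subseteq> E" "F \<inter> F' = {}"
  shows "trace F \<inter> trace F' = p ` (verts F \<inter> verts F')"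
proof -
  have "path_image (\<gamma> e) \<inter> path_image (\<gamma> e') = p ` (e \<inter> e')" if "e \<in> F" "e' \<in> F'" for e e'
  proof -
    have "e \<in> E" "e' \<in> E" "e \<noteq> e'" using that assms by auto
    then show ?thesis using plane unfolding plane_drawing_def by blast
  qed
  then have "trace F \<inter> trace F' = (\<Union>e\<in>F. \<Union>e'\<in>F'. p ` (e \<inter> e'))"
    unfolding trace_def by (simp add: Int_UN_distrib2)
  also have "\<dots> = p ` (verts F \<inter> verts F')" unfolding verts_def by blast
  finally show ?thesis .
qed

lemma arc_between_edge:
  assumes "{x, y} \<in> E"
  shows "arc_between (trace {{x, y}}) (p x) (p y)"
proof -
  let ?g = "\<gamma> {x, y}"
  have "arc ?g" "{pathstart ?g, pathfinish ?g} = {p x, p y}"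
    using assms plane unfolding plane_drawing_def by fastforce+
  then have "arc_between (path_image ?g) (p x) (p y) \<or> arc_between (path_image ?g) (p y) (p x)"
    unfolding arc_between_def doubleton_eq_iff by blast
  then show ?thesis using arc_between_commute by (auto simp: trace_def)
qed

lemma trace_graph_path: "graph_path E x y F \<Longrightarrow> arc_between (trace F) (p x) (p y)"
proof (induction rule: graph_path.induct)
  case (edge x y)
  then show ?case by (intro arc_between_edge)
next
  case (step x z y F)
  have "{{x, z}} \<inter> F = {}" using step.hyps(3) subset_verts[of "{x, z}" F] by auto
  then have "trace {{x, z}} \<inter> trace F = p ` ({x, z} \<inter> verts F)"
    using trace_Int[of "{{x, z}}" F] step.hyps(1) graph_path_edges[OF step.hyps(2)] by simp
  also have "{x, z} \<inter> verts F = {z}" using step.hyps(3) graph_path_ends(1)[OF step.hyps(2)] by auto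
  finally have "arc_between (trace {{x, z}} \<union> trace F) (p x) (p y)"
    using arc_between_edge[OF step.hyps(1)] step.IH by (intro arc_between_join) auto
  then show ?case using trace_Un[of "{{x, z}}" F] by simp
qed

lemma vertex_not_inside:
  assumes "v \<in> V" "F \<subseteq> E"
  shows "p v \<notin> inside (trace F)"
proof -
  have "trace F \<inter> outside (drawing_points V E p \<gamma>) = {}"
    using trace_subset_drawing[OF assms(2)] outside_no_overlap[of "drawing_points V E p \<gamma>"] by blast
  then show ?thesis
    using frontier_outside_Int_inside[OF closed_trace[OF assms(2)]] outer assms(1) by blast
qed

lemma path_not_inside:
  assumes "graph_path E x y F" "verts F \<noteq> {x, y}" "F' \<subseteq> E"
  shows "\<not> trace F - {p x, p y} \<subseteq> inside (trace F')"
proof -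
  have V: "verts F \<subseteq> V" using verts_subset graph_path_edges[OF assms(1)] .
  obtain u where u: "u \<in> verts F" "u \<noteq> x" "u \<noteq> y"
    using assms(2) graph_path_ends[OF assms(1)] by blast
  have "p u \<in> trace F" using u vertices_in_trace[OF graph_path_edges[OF assms(1)]] by blast
  moreover have "u \<in> V" "x \<in> V" "y \<in> V" using V u graph_path_ends[OF assms(1)] by auto
  then have "p u \<noteq> p x" "p u \<noteq> p y"
    using u plane unfolding plane_drawing_def by (meson inj_on_contraD)+
  moreover have "p u \<notin> inside (trace F')" using \<open>u \<in> V\<close> assms(3) by (rule vertex_not_inside)
  ultimately show ?thesis by blast
qed

lemma theta_curve_trace:
  assumes "theta E x y F1 F2 F3" "verts F1 \<noteq> {x, y}" "verts F2 \<noteq> {x, y}"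
  shows "theta_curve (trace F1) (trace F2) (trace F3) (p x) (p y)"
proof -
  have path: "graph_path E x y F1" "graph_path E x y F2" "graph_path E x y F3"
    and meet: "verts F1 \<inter> verts F2 = {x, y}" "verts F1 \<inter> verts F3 = {x, y}"
      "verts F2 \<inter> verts F3 = {x, y}"
    using assms(1) by (simp_all add: theta_def)
  then show ?thesis
    using path[THEN trace_graph_path] path[THEN graph_path_edges] theta_edge_disjoint[OF assms]
    by (simp add: theta_curve_def trace_Int)
qed

lemma theta_third_path_inside:
  assumes "theta E x y F1 F2 F3" "verts F1 \<noteq> {x, y}" "verts F2 \<noteq> {x, y}"
  shows "trace F3 - {p x, p y} \<subseteq> inside (trace F1 \<union> trace F2)"
proof -
  have path: "graph_path E x y F1" "graph_path E x y F2" "graph_path E x y F3"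
    using assms(1) by (simp_all add: theta_def)
  show ?thesis
    using theta_curve_inside[OF theta_curve_trace[OF assms]] path[THEN graph_path_edges]
      path_not_inside[OF path(1) assms(2), of "F2 \<union> F3"]
      path_not_inside[OF path(2) assms(3), of "F1 \<union> F3"]
    by simp
qed

lemma K23_free: "K23_subdivision_free E"
  unfolding K23_subdivision_free_def
proof (intro allI impI, rule ccontr)
  fix x y F1 F2 F3 assume theta: "theta E x y F1 F2 F3"
  then have path: "graph_path E x y F1" "graph_path E x y F2" "graph_path E x y F3"
    by (simp_all add: theta_def)
  assume "\<not> (verts F1 = {x, y} \<or> verts F2 = {x, y} \<or> verts F3 = {x, y})"
  then show False
    using theta_third_path_inside[OF theta] path_not_inside[OF path(3), of "F1 \<union> F2"]
      path[THEN graph_path_edges] by simp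
qed

lemma chord_inside_cycle:
  assumes "graph_path E a b P1" "graph_path E b c P2" "graph_path E a d P3" "graph_path E d c P4"
    and "graph_path E a c P"
    and "verts P1 \<inter> verts P2 = {b}" "verts P3 \<inter> verts P4 = {d}"
    and "verts (P1 \<union> P2) \<inter> verts (P3 \<union> P4) = {a, c}"
    and "verts (P1 \<union> P2) \<inter> verts P = {a, c}" "verts (P3 \<union> P4) \<inter> verts P = {a, c}"
  shows "trace P - {p a, p c} \<subseteq> inside (trace (P1 \<union> P2 \<union> P3 \<union> P4))"
proof -
  have "theta E a c (P1 \<union> P2) (P3 \<union> P4) P"
    unfolding theta_def
    using graph_path_append[OF assms(1,2,6)] graph_path_append[OF assms(3,4,7)] assms(5,8-10) by blast
  moreover have "b \<in> verts (P1 \<union> P2)" "b \<notin> {a, c}" "d \<in> verts (P3 \<union> P4)" "d \<notin> {a, c}"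
    using assms(1-4)[THEN graph_path_ends(2)] assms(1-4)[THEN graph_path_ends(3)] by auto
  then have "verts (P1 \<union> P2) \<noteq> {a, c}" "verts (P3 \<union> P4) \<noteq> {a, c}" by metis+
  ultimately have "trace P - {p a, p c} \<subseteq> inside (trace (P1 \<union> P2) \<union> trace (P3 \<union> P4))"
    by (rule theta_third_path_inside)
  then show ?thesis by (simp add: Un_assoc)
qed

lemma K4_branch_path_inside:
  assumes "K4_branch_paths E x y c d A1 A2 B1 B2 F3 F"
  shows "trace F3 - {p x, p y} \<subseteq> inside (trace (A1 \<union> A2 \<union> B1 \<union> B2))"
    and "trace F - {p c, p d} \<subseteq> inside (trace (A1 \<union> B1 \<union> A2 \<union> B2))"
    and "trace A1 - {p x, p c} \<subseteq> inside (trace (F3 \<union> A2 \<union> B1 \<union> F))"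
proof -
  have path: "graph_path E x c A1" "graph_path E c y A2" "graph_path E x d B1" "graph_path E d y B2"
      "graph_path E x y F3" "graph_path E c d F"
    using assms by (simp_all only: K4_branch_paths_def)
  note reverse = path[THEN graph_path_reverse]
  note meets = assms[unfolded K4_branch_paths_def]
  note distrib = Int_Un_distrib Int_Un_distrib2 Int_commute insert_commute
  show "trace F3 - {p x, p y} \<subseteq> inside (trace (A1 \<union> A2 \<union> B1 \<union> B2))"
    by (rule chord_inside_cycle[OF path(1-5)])
      (use meets in \<open>simp_all add: distrib\<close>)
  show "trace F - {p c, p d} \<subseteq> inside (trace (A1 \<union> B1 \<union> A2 \<union> B2))"
    by (rule chord_inside_cycle[OF reverse(1) path(3,2) reverse(4) path(6)])
      (use meets in \<open>simp_all add: distrib\<close>)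
  show "trace A1 - {p x, p c} \<subseteq> inside (trace (F3 \<union> A2 \<union> B1 \<union> F))"
    by (rule chord_inside_cycle[OF path(5) reverse(2) path(3) reverse(6) path(1)])
      (use meets in \<open>simp_all add: distrib\<close>)
qed

text \<open>Both \<open>F3\<close> and \<open>F\<close> run inside the cycle \<open>J\<close> formed by \<open>F1\<close> and \<open>F2\<close>. In the cycle through
  \<open>x\<close>, \<open>y\<close>, \<open>c\<close>, \<open>d\<close> that uses \<open>F3\<close> and \<open>F\<close>, the segment of \<open>F1\<close> from \<open>x\<close> to \<open>c\<close> is a chord and so
  runs inside as well, although it lies on the boundary of the outer region of \<open>J\<close>.\<close>

lemma K4_free: "K4_subdivision_free E"
  unfolding K4_subdivision_free_def
proof safe
  fix x y c d F1 F2 F3 F assume K4: "K4_subdivision E x y c d F1 F2 F3 F"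
  then have theta: "theta E x y F1 F2 F3"
    and path: "graph_path E x y F1" "graph_path E x y F2" "graph_path E x y F3" "graph_path E c d F"
    by (simp_all add: K4_subdivision_def theta_def)
  obtain A1 A2 B1 B2 where split: "F1 = A1 \<union> A2" "F2 = B1 \<union> B2"
    and branch: "K4_branch_paths E x y c d A1 A2 B1 B2 F3 F"
    by (rule K4_subdivision_split[OF K4])
  let ?J = "trace F1 \<union> trace F2" and ?K = "trace (F3 \<union> A2 \<union> B1 \<union> F)"
  have edges: "F3 \<union> A2 \<union> B1 \<union> F \<subseteq> E" "F1 \<union> F2 \<subseteq> E"
    using path[THEN graph_path_edges] split by auto
  have chords: "trace F3 - {p x, p y} \<subseteq> inside ?J" "trace F - {p c, p d} \<subseteq> inside ?J"
    using K4_branch_path_inside(1,2)[OF branch] by (simp_all add: split Un_ac)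
  have "{x, y, c, d} \<subseteq> verts (F1 \<union> F2)"
    using graph_path_ends(1,2)[OF path(1)] K4_subdivision_inner_vertices(1,2)[OF K4] by auto
  then have "{p x, p y, p c, p d} \<subseteq> ?J" using vertices_in_trace[OF edges(2)] by auto
  moreover have "trace A2 \<union> trace B1 \<subseteq> ?J" using split by auto
  ultimately have "?K \<subseteq> ?J \<union> inside ?J" using chords by (simp only: trace_Un) blast
  moreover have "frontier (outside ?J) = ?J"
    using theta_curve_Jordan(3)[OF theta_curve_trace[OF theta K4_subdivision_inner_vertices(3,4)[OF K4]]] .
  ultimately have "?J \<inter> inside ?K = {}" using closed_trace[OF edges(1)] by (intro boundary_Int_inside)
  moreover have "trace A1 \<subseteq> ?J" using split by auto
  ultimately have "trace A1 - {p x, p c} = {}" using K4_branch_path_inside(3)[OF branch] by blast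
  moreover have "graph_path E x c A1" using branch by (simp only: K4_branch_paths_def)
  ultimately show False using arc_between_endless_nonempty[OF trace_graph_path] by metis
qed

end

lemma outerplanar_subdivision_free:
  assumes "simple_graph V E" "outerplanar V E"
  shows "K23_subdivision_free E" "K4_subdivision_free E"
proof -
  obtain p \<gamma> where "outerplane_drawing V E p \<gamma>"
    using assms unfolding outerplanar_def outerplane_drawing_def by blast
  then interpret outerplane_drawing V E p \<gamma> .
  show "K23_subdivision_free E" "K4_subdivision_free E" by (rule K23_free K4_free)+
qed

subsection \<open>Longest paths\<close>

definition nbhd :: "'a set set \<Rightarrow> 'a \<Rightarrow> 'a set" where
  "nbhd E x = {y. {x, y} \<in> E}"

lemma nbhd_commute: "y \<in> nbhd E x \<longleftrightarrow> x \<in> nbhd E y"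
  by (simp add: nbhd_def insert_commute)

lemma nbhd_subset: "simple_graph V E \<Longrightarrow> nbhd E x \<subseteq> V - {x}"
  unfolding simple_graph_def nbhd_def by force

lemma finite_nbhd: "simple_graph V E \<Longrightarrow> finite (nbhd E x)"
  using nbhd_subset[of V E x] finite_subset[of "nbhd E x" V] unfolding simple_graph_def by blast

definition vertex_path :: "'a set \<Rightarrow> 'a set set \<Rightarrow> (nat \<Rightarrow> 'a) \<Rightarrow> nat \<Rightarrow> bool" where
  "vertex_path V E v n \<longleftrightarrow> inj_on v {..n} \<and> v ` {..n} \<subseteq> V \<and> (\<forall>k<n. {v k, v (Suc k)} \<in> E)"

lemma vertex_path_eq_iff: "vertex_path V E v n \<Longrightarrow> i \<le> n \<Longrightarrow> j \<le> n \<Longrightarrow> v i = v j \<longleftrightarrow> i = j"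
  unfolding vertex_path_def by (meson atMost_iff inj_on_eq_iff)

lemma vertex_path_image_Int:
  assumes "vertex_path V E v n" "S \<subseteq> {..n}" "T \<subseteq> {..n}"
  shows "v ` S \<inter> v ` T = v ` (S \<inter> T)"
  using assms inj_on_image_Int[of v "{..n}" S T] by (simp add: vertex_path_def)

lemma vertex_path_Cons:
  assumes "vertex_path V E v n" "y \<in> V" "y \<notin> v ` {..n}" "{v 0, y} \<in> E"
  shows "vertex_path V E (case_nat y v) (Suc n)"
  unfolding vertex_path_def
proof (intro conjI allI impI)
  show "inj_on (case_nat y v) {..Suc n}"
    using assms by (auto simp: vertex_path_def inj_on_def split: nat.splits)
  show "case_nat y v ` {..Suc n} \<subseteq> V"
    using assms by (auto simp: vertex_path_def image_subset_iff split: nat.splits)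
  show "{case_nat y v k, case_nat y v (Suc k)} \<in> E" if "k < Suc n" for k
    using assms that by (auto simp: vertex_path_def insert_commute split: nat.splits)
qed

definition rotate_path :: "nat \<Rightarrow> (nat \<Rightarrow> 'a) \<Rightarrow> nat \<Rightarrow> 'a" where
  "rotate_path h v k = (if k \<le> h then v (h - k) else v k)"

lemma vertex_path_rotate:
  assumes "vertex_path V E v n" "h < n" "{v 0, v (Suc h)} \<in> E"
  shows "vertex_path V E (rotate_path h v) n"
  unfolding vertex_path_def
proof (intro conjI allI impI)
  show "inj_on (rotate_path h v) {..n}"
    using assms(2) vertex_path_eq_iff[OF assms(1)]
    by (auto simp: inj_on_def rotate_path_def split: if_splits)
  show "rotate_path h v ` {..n} \<subseteq> V"
    using assms by (auto simp: vertex_path_def rotate_path_def)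
  show "{rotate_path h v k, rotate_path h v (Suc k)} \<in> E" if "k < n" for k
  proof -
    consider "k < h" | "k = h" | "h < k" by linarith
    then show ?thesis
    proof cases
      assume "k < h"
      then have "{v (h - Suc k), v (Suc (h - Suc k))} \<in> E" "Suc (h - Suc k) = h - k"
        using assms(1,2) by (auto simp: vertex_path_def)
      then show ?thesis using \<open>k < h\<close> by (simp add: rotate_path_def insert_commute)
    qed (use assms that in \<open>simp_all add: vertex_path_def rotate_path_def\<close>)
  qed
qed

definition segment :: "(nat \<Rightarrow> 'a) \<Rightarrow> nat \<Rightarrow> nat \<Rightarrow> 'a set set" where
  "segment v i j = (\<lambda>k. {v k, v (Suc k)}) ` {i..<j}"

lemma verts_segment:
  assumes "i < j"
  shows "verts (segment v i j) = v ` {i..j}"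
proof -
  have "verts (segment v i j) = v ` {i..<j} \<union> (\<lambda>k. v (Suc k)) ` {i..<j}"
    by (auto simp: verts_def segment_def)
  also have "\<dots> = v ` ({i..<j} \<union> Suc ` {i..<j})" by (simp only: image_Un image_image)
  also have "{i..<j} \<union> Suc ` {i..<j} = {i..j}"
    using assms by (auto simp: image_Suc_atLeastLessThan)
  finally show ?thesis .
qed

lemma graph_path_segment:
  assumes "i < j" "vertex_path V E v n" "j \<le> n"
  shows "graph_path E (v i) (v j) (segment v i j)"
  using assms
proof (induction rule: strict_inc_induct)
  case (base i)
  have "segment v i j = {{v i, v (Suc i)}}"
    using base(1) by (simp add: segment_def)
  then show ?case
    using base vertex_path_eq_iff[OF base(2), of i "Suc i"]
    by (auto simp: vertex_path_def intro: graph_path.edge)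
next
  case (step i)
  have "{i..<j} = insert i {Suc i..<j}" using step.hyps by auto
  then have "segment v i j = insert {v i, v (Suc i)} (segment v (Suc i) j)"
    by (simp add: segment_def)
  moreover have "v i \<notin> verts (segment v (Suc i) j)"
    using step.hyps step.prems by (auto simp: verts_segment vertex_path_eq_iff[OF step.prems(1)])
  ultimately show ?case
    using step by (auto simp: vertex_path_def intro: graph_path.step)
qed

lemma no_crossing_chords:
  assumes free: "K4_subdivision_free E" and path: "vertex_path V E v n"
    and closing: "{v 0, v j} \<in> E" and chords: "{v 0, v (Suc h)} \<in> E" "{v h, v l} \<in> E"
    and order: "0 < h" "Suc h < l" "l \<le> j" "j \<le> n"
  shows False
proof -
  note eq_iff = vertex_path_eq_iff[OF path] and Int = vertex_path_image_Int[OF path]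
  define near far chord bridge where "near = segment v 0 (Suc h)"
    and "far = insert {v 0, v j} (segment v (Suc h) j)"
    and "chord = {{v 0, v (Suc h)}}" and "bridge = {{v h, v l}}"
  have verts: "verts near = v ` {0..Suc h}" "verts far = v ` ({0} \<union> {Suc h..j})"
      "verts chord = v ` {0, Suc h}" "verts bridge = v ` {h, l}"
    using order by (auto simp: near_def far_def chord_def bridge_def verts_segment)
  have subsets: "{0..Suc h} \<subseteq> {..n}" "{0} \<union> {Suc h..j} \<subseteq> {..n}" "{0, Suc h} \<subseteq> {..n}" "{h, l} \<subseteq> {..n}"
    using order by auto
  have "v 0 \<notin> v ` {Suc h..j}" using order by (auto simp: eq_iff)
  moreover have "graph_path E (v j) (v (Suc h)) (segment v (Suc h) j)"
    by (rule graph_path_reverse, rule graph_path_segment[OF _ path]) (use order in auto)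
  ultimately have "graph_path E (v 0) (v (Suc h)) far"
    unfolding far_def using closing order by (intro graph_path.step) (auto simp: verts_segment)
  moreover have "graph_path E (v 0) (v (Suc h)) near"
    unfolding near_def using graph_path_segment[OF _ path] order by simp
  moreover have "graph_path E (v 0) (v (Suc h)) chord" "graph_path E (v h) (v l) bridge"
    unfolding chord_def bridge_def using chords order by (auto simp: eq_iff intro!: graph_path.edge)
  moreover have "{0..Suc h} \<inter> ({0} \<union> {Suc h..j}) = {0, Suc h}" "{0..Suc h} \<inter> {0, Suc h} = {0, Suc h}"
      "({0} \<union> {Suc h..j}) \<inter> {0, Suc h} = {0, Suc h}"
      "{h, l} \<inter> {0..Suc h} = {h}" "{h, l} \<inter> ({0} \<union> {Suc h..j}) = {l}" "{h, l} \<inter> {0, Suc h} = {}"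
    using order by auto
  then have "verts near \<inter> verts far = v ` {0, Suc h}" "verts near \<inter> verts chord = v ` {0, Suc h}"
      "verts far \<inter> verts chord = v ` {0, Suc h}"
      "verts bridge \<inter> verts near = v ` {h}" "verts bridge \<inter> verts far = v ` {l}"
      "verts bridge \<inter> verts chord = v ` {}"
    by (simp_all only: verts Int[OF subsets(1,2)] Int[OF subsets(1,3)] Int[OF subsets(2,3)]
        Int[OF subsets(4,1)] Int[OF subsets(4,2)] Int[OF subsets(4,3)])
  ultimately have "K4_subdivision E (v 0) (v (Suc h)) (v h) (v l) near far chord bridge"
    by (simp add: K4_subdivision_def theta_def)
  then show False using free unfolding K4_subdivision_free_def by blast
qed

text \<open>Rotating the path at \<open>h\<close> swaps the roles of its ends \<open>v 0\<close> and \<open>v h\<close>.\<close>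

lemma no_two_long_end_chords:
  assumes free: "K4_subdivision_free E" and path: "vertex_path V E v n"
    and h: "0 < h" "h < n" "{v 0, v (Suc h)} \<in> E"
    and j: "Suc h < j" "j \<le> n" "{v 0, v j} \<in> E" and l: "Suc h < l" "l \<le> n" "{v h, v l} \<in> E"
  shows False
proof (cases "l \<le> j")
  case True
  then show False using no_crossing_chords[OF free path j(3) h(3) l(3) h(1) l(1) _ j(2)] by blast
next
  case False
  let ?w = "rotate_path h v"
  have "{?w 0, ?w l} \<in> E" "{?w h, ?w j} \<in> E" "{?w 0, ?w (Suc h)} \<in> E"
    using j l h(2) path by (simp_all add: rotate_path_def vertex_path_def)
  then show False
    using no_crossing_chords[OF free vertex_path_rotate[OF path h(2,3)], of l h j] h(1) j(1) l(2) False
    by simp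
qed

definition longest_path :: "'a set \<Rightarrow> 'a set set \<Rightarrow> (nat \<Rightarrow> 'a) \<Rightarrow> nat \<Rightarrow> bool" where
  "longest_path V E v n \<longleftrightarrow> vertex_path V E v n \<and> (\<forall>u m. vertex_path V E u m \<longrightarrow> m \<le> n)"

lemma longest_path_exists:
  assumes "finite V" "V \<noteq> {}"
  shows "\<exists>v n. longest_path V E v n"
proof -
  obtain a where "a \<in> V" using \<open>V \<noteq> {}\<close> by blast
  then have "\<exists>v. vertex_path V E v 0" by (auto simp: vertex_path_def)
  moreover have "n \<le> card V" if "\<exists>v. vertex_path V E v n" for n
    using that card_inj_on_le[of _ "{..n}" V] assms(1) by (fastforce simp: vertex_path_def)
  ultimately show ?thesis
    using ex_has_greatest_nat[of "\<lambda>n. \<exists>v. vertex_path V E v n" 0 id "Suc (card V)"]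
    unfolding longest_path_def by (metis id_apply le_imp_less_Suc)
qed

lemma longest_path_rotate:
  assumes "longest_path V E v n" "h < n" "{v 0, v (Suc h)} \<in> E"
  shows "longest_path V E (rotate_path h v) n"
  using assms vertex_path_rotate unfolding longest_path_def by blast

lemma longest_path_nbhd:
  assumes "simple_graph V E" "longest_path V E v n"
  shows "nbhd E (v 0) \<subseteq> v ` {1..n}"
proof
  fix y assume y: "y \<in> nbhd E (v 0)"
  then have "y \<in> V" "y \<noteq> v 0" "{v 0, y} \<in> E"
    using nbhd_subset[OF assms(1)] by (auto simp: nbhd_def)
  moreover have "\<not> vertex_path V E (case_nat y v) (Suc n)"
    using assms(2) Suc_n_not_le_n unfolding longest_path_def by blast
  moreover have "vertex_path V E v n" using assms(2) by (simp add: longest_path_def)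
  ultimately have "y \<in> v ` {..n}" using vertex_path_Cons[of V E v n y] by blast
  then obtain k where "k \<le> n" "y = v k" by blast
  then show "y \<in> v ` {1..n}" using \<open>y \<noteq> v 0\<close> by (cases k) auto
qed

definition nonseparating :: "'a set set \<Rightarrow> 'a \<Rightarrow> bool" where
  "nonseparating E w \<longleftrightarrow>
     (\<forall>x\<in>nbhd E w. \<forall>y\<in>nbhd E w. x \<noteq> y \<longrightarrow> (\<exists>F. graph_path E x y F \<and> w \<notin> verts F))"

lemma longest_path_end_nonseparating:
  assumes "simple_graph V E" "longest_path V E v n"
  shows "nonseparating E (v 0)"
  unfolding nonseparating_def
proof (intro ballI impI)
  fix x y assume xy: "x \<in> nbhd E (v 0)" "y \<in> nbhd E (v 0)" "x \<noteq> y"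
  have path: "vertex_path V E v n" using assms(2) by (simp add: longest_path_def)
  have segment: "graph_path E (v k) (v l) (segment v k l) \<and> v 0 \<notin> verts (segment v k l)"
    if "k \<in> {1..n}" "k < l" "l \<in> {1..n}" for k l
    using that graph_path_segment[OF that(2) path]
    by (auto simp: verts_segment vertex_path_eq_iff[OF path])
  obtain k l where "k \<in> {1..n}" "l \<in> {1..n}" "x = v k" "y = v l" "k \<noteq> l"
    using longest_path_nbhd[OF assms] xy by blast
  then show "\<exists>F. graph_path E x y F \<and> v 0 \<notin> verts F"
    using segment[of k l] segment[of l k] graph_path_reverse by (metis linorder_neqE_nat)
qed

lemma longest_path_chord:
  assumes "simple_graph V E" "longest_path V E v n" "2 < card (nbhd E (v 0))"
  shows "\<exists>k. 2 \<le> k \<and> k \<le> n \<and> k \<noteq> i \<and> {v 0, v k} \<in> E"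
proof -
  have "card {v 1, v i} \<le> 2" using card_insert_le_m1[of 2 "{v i}" "v 1"] by simp
  then have "\<not> nbhd E (v 0) \<subseteq> {v 1, v i}"
    using assms(3) card_mono[of "{v 1, v i}" "nbhd E (v 0)"] by fastforce
  then obtain y where y: "y \<in> nbhd E (v 0)" "y \<noteq> v 1" "y \<noteq> v i" by blast
  then obtain k where k: "k \<in> {1..n}" "y = v k" using longest_path_nbhd[OF assms(1,2)] by blast
  then have "k \<noteq> 1" "k \<noteq> i" using y by auto
  then show ?thesis using y(1) k by (intro exI[of _ k]) (auto simp: nbhd_def)
qed

text \<open>Among the longest paths, take one with a shortest chord at its end, from \<open>v 0\<close> to
  \<open>v (Suc h)\<close>. If \<open>v 0\<close> and the rotated end \<open>v h\<close> both had a third neighbour, two chords would cross.\<close>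

lemma longest_path_end_degree_le_2:
  assumes simple: "simple_graph V E" and "V \<noteq> {}" and free: "K4_subdivision_free E"
  shows "\<exists>v n. longest_path V E v n \<and> card (nbhd E (v 0)) \<le> 2"
proof (rule ccontr)
  assume many_nbhds: "\<not> ?thesis"
  obtain u n where "longest_path V E u n"
    using longest_path_exists simple \<open>V \<noteq> {}\<close> by (metis simple_graph_def)
  have chord: "\<exists>k. 2 \<le> k \<and> k \<le> n \<and> k \<noteq> i \<and> {v 0, v k} \<in> E" if "longest_path V E v n" for v i
    using longest_path_chord[OF simple that] many_nbhds that by (metis not_le)
  define end_chord where
    "end_chord = (\<lambda>(v, i). longest_path V E v n \<and> 2 \<le> i \<and> i \<le> n \<and> {v 0, v i} \<in> E)"
  have "\<exists>a. end_chord a"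
    using chord[OF \<open>longest_path V E u n\<close>] \<open>longest_path V E u n\<close> unfolding end_chord_def by blast
  then obtain v i where i: "end_chord (v, i)" "\<And>w k. end_chord (w, k) \<Longrightarrow> i \<le> k"
    using ex_has_least_nat[of end_chord _ snd] by (metis prod.collapse snd_conv)
  define h where "h = i - 1"
  have v: "longest_path V E v n" "0 < h" "h < n" "{v 0, v (Suc h)} \<in> E" and "i = Suc h"
    using i(1) by (auto simp: end_chord_def h_def)
  have third: "\<exists>k>Suc h. k \<le> n \<and> {u 0, u k} \<in> E" if "longest_path V E u n" for u
    using chord[OF that, of i] i(2)[of u] that unfolding end_chord_def \<open>i = Suc h\<close>
    by (metis (mono_tags, lifting) case_prodI le_neq_implies_less)
  obtain j where j: "Suc h < j" "j \<le> n" "{v 0, v j} \<in> E" using third[OF v(1)] by blast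
  obtain l where l: "Suc h < l" "l \<le> n" "{v h, v l} \<in> E"
    using third[OF longest_path_rotate[OF v(1,3,4)]] by (auto simp: rotate_path_def)
  have "vertex_path V E v n" using v(1) by (simp add: longest_path_def)
  then show False by (rule no_two_long_end_chords[OF free _ v(2-4) j l])
qed

lemma K4_subdivision_free_end_vertex:
  assumes "simple_graph V E" "V \<noteq> {}" "K4_subdivision_free E"
  shows "\<exists>w\<in>V. card (nbhd E w) \<le> 2 \<and> nonseparating E w"
proof -
  obtain v n where v: "longest_path V E v n" "card (nbhd E (v 0)) \<le> 2"
    using longest_path_end_degree_le_2[OF assms] by blast
  then have "v 0 \<in> V" by (auto simp: longest_path_def vertex_path_def)
  then show ?thesis
    using v(2) longest_path_end_nonseparating[OF assms(1) v(1)] by blast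
qed

subsection \<open>Light vertices\<close>

lemma card_common_nbhd_le_1:
  assumes simple: "simple_graph V E" and free: "K23_subdivision_free E"
    and path: "graph_path E x y F" "verts F \<noteq> {x, y}"
  shows "card (nbhd E x \<inter> nbhd E y - verts F) \<le> 1"
proof (rule ccontr)
  let ?C = "nbhd E x \<inter> nbhd E y - verts F"
  assume "\<not> ?thesis"
  then have "2 \<le> card ?C" by simp
  then obtain A where "A \<subseteq> ?C" "card A = 2" by (meson obtain_subset_with_card_n)
  then obtain a b where ab: "a \<in> ?C" "b \<in> ?C" "a \<noteq> b" by (auto simp: card_2_iff)
  have ends: "x \<in> verts F" "y \<in> verts F" "x \<noteq> y" using graph_path_ends[OF path(1)] .
  have two_edges: "graph_path E x y {{x, c}, {c, y}}" if "c \<in> ?C" for c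
    using that ends by (intro graph_path_two_edges) (auto simp: nbhd_def insert_commute)
  have theta: "theta E x y {{x, a}, {a, y}} {{x, b}, {b, y}} F"
    unfolding theta_def using two_edges[OF ab(1)] two_edges[OF ab(2)] path(1) ab ends by auto
  have "a \<in> verts {{x, a}, {a, y}} - {x, y}" "b \<in> verts {{x, b}, {b, y}} - {x, y}"
    using ab(1,2) ends by auto
  then show False
    using free[unfolded K23_subdivision_free_def, rule_format, OF theta] path(2) by (metis DiffE)
qed

lemma card_common_nbhd_le_2:
  assumes simple: "simple_graph V E" and free: "K23_subdivision_free E" and "x \<noteq> y"
  shows "card (nbhd E x \<inter> nbhd E y) \<le> 2"
proof (cases "nbhd E x \<inter> nbhd E y = {}")
  case False
  then obtain a where a: "a \<in> nbhd E x \<inter> nbhd E y" by blast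
  have loopless: "z \<notin> nbhd E z" for z using nbhd_subset[OF simple] by blast
  have "a \<noteq> x" "a \<noteq> y" using a loopless by auto
  then have "graph_path E x y {{x, a}, {a, y}}"
    using a \<open>x \<noteq> y\<close> by (intro graph_path_two_edges) (auto simp: nbhd_def insert_commute)
  moreover have "verts {{x, a}, {a, y}} \<noteq> {x, y}" using \<open>a \<noteq> x\<close> \<open>a \<noteq> y\<close> by auto
  ultimately have "card (nbhd E x \<inter> nbhd E y - verts {{x, a}, {a, y}}) \<le> 1"
    by (rule card_common_nbhd_le_1[OF simple free])
  moreover have "nbhd E x \<inter> nbhd E y - verts {{x, a}, {a, y}} = nbhd E x \<inter> nbhd E y - {a}"
    using loopless by auto
  ultimately show ?thesis
    using a finite_nbhd[OF simple] by (simp add: card_Diff_singleton)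
qed simp

definition suppressed :: "'a set set \<Rightarrow> 'a set \<Rightarrow> 'a set \<Rightarrow> 'a set" where
  "suppressed E T e = {x \<in> T. nbhd E x = e}"

definition suppress :: "'a set \<Rightarrow> 'a set set \<Rightarrow> 'a set \<Rightarrow> 'a set set" where
  "suppress V E T = {e. e \<subseteq> V - T \<and> card e = 2 \<and> (e \<in> E \<or> suppressed E T e \<noteq> {})}"

lemma simple_graph_suppress: "simple_graph V E \<Longrightarrow> simple_graph (V - T) (suppress V E T)"
  by (auto simp: simple_graph_def suppress_def)

lemma suppress_edge_path:
  assumes "e \<in> suppress V E T"
  shows "\<exists>F. (\<forall>x y. e = {x, y} \<longrightarrow> graph_path E x y F) \<and>
    (verts F = e \<or> (\<exists>m\<in>suppressed E T e. verts F = insert m e))"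
proof -
  obtain x y where xy: "e = {x, y}" "x \<noteq> y" using assms by (auto simp: suppress_def card_2_iff)
  have both_directions: "\<forall>x' y'. e = {x', y'} \<longrightarrow> graph_path E x' y' F" if "graph_path E x y F" for F
    using that graph_path_reverse[OF that] xy(1) by (auto simp: doubleton_eq_iff)
  show ?thesis
  proof (cases "e \<in> E")
    case True
    then have "graph_path E x y {e}" using xy by (auto intro: graph_path.edge)
    moreover have "verts {e} = e" by simp
    ultimately show ?thesis
      by (intro exI[of _ "{e}"] conjI disjI1 both_directions)
  next
    case False
    then obtain m where m: "m \<in> suppressed E T e" using assms by (auto simp: suppress_def)
    then have "x \<in> nbhd E m" "y \<in> nbhd E m" "m \<notin> e"
      using assms xy by (auto simp: suppress_def suppressed_def)
    then have "graph_path E x y {{x, m}, {m, y}}"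
      using xy by (intro graph_path_two_edges) (auto simp: nbhd_def insert_commute)
    moreover have "verts {{x, m}, {m, y}} = insert m e" using xy by auto
    ultimately show ?thesis using both_directions m by blast
  qed
qed

lemma subdivision_suppress:
  obtains P where "subdivision (suppress V E T) E P"
    "\<And>e. e \<in> suppress V E T \<Longrightarrow> verts (P e) \<subseteq> e \<union> suppressed E T e"
proof -
  obtain P where path: "\<And>e x y. e \<in> suppress V E T \<Longrightarrow> e = {x, y} \<Longrightarrow> graph_path E x y (P e)"
    and verts: "\<And>e. e \<in> suppress V E T \<Longrightarrow>
      verts (P e) = e \<or> (\<exists>m\<in>suppressed E T e. verts (P e) = insert m e)"
    using suppress_edge_path[of _ V E T] by metis
  have "verts (P e) \<inter> verts (P e') = e \<inter> e'"
    if e: "e \<in> suppress V E T" "e' \<in> suppress V E T" "e \<noteq> e'" for e e'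
  proof -
    have "m \<notin> e \<union> e'" if "m \<in> suppressed E T e \<union> suppressed E T e'" for m
      using that e(1,2) by (auto simp: suppress_def suppressed_def)
    moreover have "suppressed E T e \<inter> suppressed E T e' = {}"
      using e(3) by (auto simp: suppressed_def)
    ultimately show ?thesis using verts[OF e(1)] verts[OF e(2)] by (elim disjE bexE) auto
  qed
  then have "subdivision (suppress V E T) E P" using path by (simp add: subdivision_def)
  moreover have "verts (P e) \<subseteq> e \<union> suppressed E T e" if "e \<in> suppress V E T" for e
    using verts[OF that] by auto
  ultimately show thesis by (rule that)
qed

lemma suppressed_subset_common_nbhd: "suppressed E T {w, u} \<subseteq> nbhd E w \<inter> nbhd E u"
  using nbhd_commute[of _ E] by (auto simp: suppressed_def)

lemma card_suppressed_le_2: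
  assumes "simple_graph V E" "K23_subdivision_free E" "w \<noteq> u"
  shows "card (suppressed E T {w, u}) \<le> 2"
proof -
  have "card (suppressed E T {w, u}) \<le> card (nbhd E w \<inter> nbhd E u)"
    using finite_nbhd[OF assms(1)] by (intro card_mono suppressed_subset_common_nbhd) auto
  also have "\<dots> \<le> 2" using assms by (rule card_common_nbhd_le_2)
  finally show ?thesis .
qed

lemma card_suppressed_le_1:
  assumes simple: "simple_graph V E" and free: "K23_subdivision_free E"
    and path: "graph_path (suppress V E T) w u F" "verts F \<noteq> {w, u}"
  shows "card (suppressed E T {w, u}) \<le> 1"
proof -
  obtain P where P: "subdivision (suppress V E T) E P"
    "\<And>e. e \<in> suppress V E T \<Longrightarrow> verts (P e) \<subseteq> e \<union> suppressed E T e"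
    using subdivision_suppress by blast
  define F' where "F' = \<Union>(P ` F)"
  have F: "F \<subseteq> suppress V E T" using graph_path_edges[OF path(1)] .
  have "{w, u} \<notin> F" using graph_path_direct_edge[OF path(1)] path(2) by blast
  have verts_F': "verts F' = (\<Union>e\<in>F. verts (P e))" by (auto simp: F'_def verts_def)
  have "e \<subseteq> verts (P e)" if "e \<in> F" for e
    using subdivision_edge_subset[OF P(1) subsetD[OF F that]] graph_path_card_edge[OF path(1) that] .
  then have "verts F \<subseteq> verts F'" unfolding verts_F' by (fastforce simp: verts_def[of F])
  then have inner: "verts F' \<noteq> {w, u}"
    using path(2) graph_path_ends[OF path(1)] by blast
  have "x \<notin> verts F'" if x: "x \<in> suppressed E T {w, u}" for x
  proof -
    have "x \<notin> verts (P e)" if "e \<in> F" for e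
    proof -
      have "e \<in> suppress V E T" "e \<noteq> {w, u}" using that F \<open>{w, u} \<notin> F\<close> by auto
      moreover from this have "x \<notin> e" using x by (auto simp: suppress_def suppressed_def)
      ultimately show ?thesis using P(2)[of e] x by (auto simp: suppressed_def)
    qed
    then show ?thesis unfolding verts_F' by blast
  qed
  then have "suppressed E T {w, u} \<subseteq> nbhd E w \<inter> nbhd E u - verts F'"
    using suppressed_subset_common_nbhd[of E T w u] by blast
  moreover have "card (nbhd E w \<inter> nbhd E u - verts F') \<le> 1"
    using card_common_nbhd_le_1[OF simple free graph_path_subdivision[OF P(1) path(1)]] inner
    unfolding F'_def by blast
  ultimately show ?thesis
    using finite_nbhd[OF simple] card_mono by (meson finite_Diff finite_Int le_trans)
qed

lemma nonseparating_card_suppressed_le_1: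
  assumes simple: "simple_graph V E" and free: "K23_subdivision_free E"
    and nonsep: "nonseparating (suppress V E T) w"
    and u: "u \<in> nbhd (suppress V E T) w" and u': "u' \<in> nbhd (suppress V E T) w" "u' \<noteq> u"
  shows "card (suppressed E T {w, u}) \<le> 1"
proof -
  obtain F where F: "graph_path (suppress V E T) u' u F" "w \<notin> verts F"
    using nonsep u u' unfolding nonseparating_def by blast
  have "graph_path (suppress V E T) w u (insert {w, u'} F)"
    using F u'(1) by (intro graph_path.step) (auto simp: nbhd_def)
  moreover have "verts (insert {w, u'} F) \<noteq> {w, u}"
    using graph_path_ends(1)[OF F(1)] F(2) u'(2) by auto
  ultimately show ?thesis by (rule card_suppressed_le_1[OF simple free])
qed

lemma nbhd_subset_suppress:
  assumes simple: "simple_graph V E" and T: "\<And>x. x \<in> T \<Longrightarrow> card (nbhd E x) = 2 \<and> nbhd E x \<inter> T = {}"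
    and w: "w \<in> V - T"
  shows "nbhd E w \<subseteq> (\<Union>u\<in>nbhd (suppress V E T) w. insert u (suppressed E T {w, u}))"
proof
  fix y assume y: "y \<in> nbhd E w"
  then have yV: "y \<in> V" "y \<noteq> w" using nbhd_subset[OF simple] by blast+
  show "y \<in> (\<Union>u\<in>nbhd (suppress V E T) w. insert u (suppressed E T {w, u}))"
  proof (cases "y \<in> T")
    case False
    then have "y \<in> nbhd (suppress V E T) w" using y yV w by (auto simp: suppress_def nbhd_def)
    then show ?thesis by blast
  next
    case True
    have "w \<in> nbhd E y" using y nbhd_commute by metis
    then obtain u where u: "nbhd E y = {w, u}"
      using T[OF True] by (metis card_2_iff insertE insert_commute singletonD)
    then have y_suppressed: "y \<in> suppressed E T {w, u}" using True by (simp add: suppressed_def)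
    then have "{w, u} \<in> suppress V E T"
      using u T[OF True] nbhd_subset[OF simple, of y] by (auto simp: suppress_def)
    then show ?thesis using y_suppressed by (auto simp: nbhd_def)
  qed
qed

lemma suppress_card_nbhd_le_4:
  assumes simple: "simple_graph V E" and free: "K23_subdivision_free E"
    and T: "\<And>x. x \<in> T \<Longrightarrow> card (nbhd E x) = 2 \<and> nbhd E x \<inter> T = {}" and w: "w \<in> V - T"
    and card: "card (nbhd (suppress V E T) w) \<le> 2" and nonsep: "nonseparating (suppress V E T) w"
  shows "card (nbhd E w) \<le> 4"
proof -
  define N where "N = nbhd (suppress V E T) w"
  have finite_N: "finite N" unfolding N_def using simple_graph_suppress[OF simple] by (rule finite_nbhd)
  have finite_suppressed: "finite (suppressed E T {w, u})" for u
    using finite_nbhd[OF simple] by (intro finite_subset[OF suppressed_subset_common_nbhd]) simp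
  have "card (nbhd E w) \<le> card (\<Union>u\<in>N. insert u (suppressed E T {w, u}))"
    using nbhd_subset_suppress[OF simple T w] finite_N finite_suppressed unfolding N_def
    by (intro card_mono) auto
  also have "\<dots> \<le> (\<Sum>u\<in>N. card (insert u (suppressed E T {w, u})))" using finite_N by (rule card_UN_le)
  also have "\<dots> \<le> (\<Sum>u\<in>N. Suc (card (suppressed E T {w, u})))"
    by (intro sum_mono) (simp add: card_insert_if finite_suppressed)
  also have "\<dots> \<le> 4"
  proof (cases "\<exists>u\<in>N. \<exists>u'\<in>N. u \<noteq> u'")
    case True
    have "Suc (card (suppressed E T {w, u})) \<le> 2" if "u \<in> N" for u
    proof -
      obtain u' where "u' \<in> N" "u' \<noteq> u" using True by blast
      then show ?thesis
        using nonseparating_card_suppressed_le_1[OF simple free nonsep] that unfolding N_def by force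
    qed
    then have "(\<Sum>u\<in>N. Suc (card (suppressed E T {w, u}))) \<le> card N * 2"
      by (intro sum_bounded_above[where 'a = nat, simplified])
    then show ?thesis using card by (simp add: N_def)
  next
    case False
    have "u \<noteq> w" if "u \<in> N" for u
      using that nbhd_subset[OF simple_graph_suppress[OF simple]] unfolding N_def by blast
    then have "Suc (card (suppressed E T {w, u})) \<le> 3" if "u \<in> N" for u
      using that card_suppressed_le_2[OF simple free, of w u T] by force
    then have "(\<Sum>u\<in>N. Suc (card (suppressed E T {w, u}))) \<le> card N * 3"
      by (intro sum_bounded_above[where 'a = nat, simplified])
    moreover have "card N \<le> 1" using False finite_N by (simp add: card_le_Suc0_iff_eq)
    ultimately show ?thesis by linarith
  qed
  finally show ?thesis .
qed

definition has_light_vertex :: "'a set \<Rightarrow> 'a set set \<Rightarrow> bool" where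
  "has_light_vertex V E \<longleftrightarrow>
     (\<exists>x\<in>V. card (nbhd E x) \<le> 1 \<or> card (nbhd E x) = 2 \<and> (\<exists>y\<in>nbhd E x. card (nbhd E y) \<le> 4))"

text \<open>In a counterexample the vertices of degree 2 are independent; suppress them all. The suppressed
  graph has an end vertex \<open>w\<close> of degree at most 2, which has degree at most 4 in the original graph.\<close>

lemma subdivision_free_has_light_vertex:
  assumes simple: "simple_graph V E" and "V \<noteq> {}"
    and K23: "K23_subdivision_free E" and K4: "K4_subdivision_free E"
  shows "has_light_vertex V E"
proof (rule ccontr)
  assume "\<not> ?thesis"
  then have degree_gt_1: "\<And>x. x \<in> V \<Longrightarrow> 1 < card (nbhd E x)"
    and degree_gt_4: "\<And>x y. x \<in> V \<Longrightarrow> card (nbhd E x) = 2 \<Longrightarrow> y \<in> nbhd E x \<Longrightarrow> 4 < card (nbhd E y)"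
    unfolding has_light_vertex_def by (meson not_le)+
  define T where "T = {x \<in> V. card (nbhd E x) = 2}"
  have T: "card (nbhd E x) = 2 \<and> nbhd E x \<inter> T = {}" if "x \<in> T" for x
    using that degree_gt_4 by (fastforce simp: T_def)
  have "V - T \<noteq> {}"
  proof
    assume "V - T = {}"
    then obtain x where "x \<in> T" using \<open>V \<noteq> {}\<close> by blast
    then have "nbhd E x \<noteq> {}" using T[of x] by auto
    moreover have "nbhd E x \<subseteq> V - T" using T[OF \<open>x \<in> T\<close>] nbhd_subset[OF simple] by blast
    ultimately show False using \<open>V - T = {}\<close> by simp
  qed
  obtain P where "subdivision (suppress V E T) E P" by (rule subdivision_suppress)
  then have "K4_subdivision_free (suppress V E T)" using K4 by (rule K4_subdivision_free_subdivision)
  then obtain w where w: "w \<in> V - T" "card (nbhd (suppress V E T) w) \<le> 2"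
      "nonseparating (suppress V E T) w"
    using K4_subdivision_free_end_vertex[OF simple_graph_suppress[OF simple] \<open>V - T \<noteq> {}\<close>] by blast
  have "card (nbhd E w) \<le> 4" using T w by (rule suppress_card_nbhd_le_4[OF simple K23])
  have "2 < card (nbhd E w)" using degree_gt_1[of w] w(1) by (auto simp: T_def)
  then have "\<not> nbhd E w \<subseteq> nbhd (suppress V E T) w"
    using w(2) card_mono[OF finite_nbhd[OF simple_graph_suppress[OF simple]]] by (meson le_trans not_le)
  then obtain y where y: "y \<in> nbhd E w" "y \<notin> nbhd (suppress V E T) w" by blast
  then have "y \<in> V" "y \<noteq> w" using nbhd_subset[OF simple] by blast+
  then have "y \<in> T" using y w(1) by (auto simp: nbhd_def suppress_def)
  moreover have "w \<in> nbhd E y" using y(1) nbhd_commute by metis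
  ultimately show False
    using degree_gt_4[of y w] \<open>card (nbhd E w) \<le> 4\<close> by (simp add: T_def)
qed

definition hereditarily_light :: "'a set \<Rightarrow> 'a set set \<Rightarrow> bool" where
  "hereditarily_light V E \<longleftrightarrow> (\<forall>W\<subseteq>V. W \<noteq> {} \<longrightarrow> has_light_vertex W (induced_edges E W))"

lemma subdivision_free_hereditarily_light:
  assumes "simple_graph V E" "K23_subdivision_free E" "K4_subdivision_free E"
  shows "hereditarily_light V E"
  unfolding hereditarily_light_def
proof (intro allI impI)
  fix W assume W: "W \<subseteq> V" "W \<noteq> {}"
  have "simple_graph W (induced_edges E W)"
    using assms(1) W(1) finite_subset by (auto simp: simple_graph_def induced_edges_def)
  moreover have "induced_edges E W \<subseteq> E" by (auto simp: induced_edges_def)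
  ultimately show "has_light_vertex W (induced_edges E W)"
    using K23_subdivision_free_mono[OF assms(2)] K4_subdivision_free_mono[OF assms(3)] W(2)
    by (intro subdivision_free_has_light_vertex)
qed

subsection \<open>Forests\<close>

lemma forest_induced_edges_iff: "forest W (induced_edges E W) \<longleftrightarrow> forest W E"
proof -
  have "{vs ! i, vs ! (Suc i mod length vs)} \<subseteq> W"
    if "set vs \<subseteq> W" "i < length vs" for vs :: "'a list" and i
  proof -
    have "Suc i mod length vs < length vs" using that(2) by (intro mod_less_divisor) auto
    then show ?thesis using that nth_mem by auto
  qed
  then show ?thesis unfolding forest_def is_cycle_def induced_edges_def by blast
qed

lemma card_le_2_imp_forest:
  assumes "finite W" "card W \<le> 2"
  shows "forest W E"
proof -
  have "length vs \<le> 2" if "set vs \<subseteq> W" "distinct vs" for vs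
    using that card_mono[OF assms(1)] assms(2) by (metis distinct_card le_trans)
  then show ?thesis unfolding forest_def is_cycle_def by force
qed

lemma is_cycle_card_nbhd:
  assumes cycle: "is_cycle V E vs" and "s \<in> set vs"
  shows "2 \<le> card (nbhd E s \<inter> (set vs - {s}))"
proof -
  define n where "n = length vs"
  have vs: "distinct vs" "3 \<le> n" "\<And>i. i < n \<Longrightarrow> {vs ! i, vs ! (Suc i mod n)} \<in> E"
    using cycle by (auto simp: is_cycle_def n_def)
  obtain k where k: "k < n" "s = vs ! k" using \<open>s \<in> set vs\<close> by (auto simp: in_set_conv_nth n_def)
  define succ where "succ = (if Suc k = n then 0 else Suc k)"
  define pred where "pred = (if k = 0 then n - 1 else k - 1)"
  have idx: "succ < n" "pred < n" "succ \<noteq> k" "pred \<noteq> k" "succ \<noteq> pred"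
    and mods: "Suc k mod n = succ" "Suc pred mod n = k"
    using k(1) vs(2) by (auto simp: succ_def pred_def)
  have "{vs ! succ, vs ! pred} \<subseteq> set vs - {s}"
    using idx k vs(1) by (auto simp: n_def nth_eq_iff_index_eq)
  moreover have "{vs ! succ, vs ! pred} \<subseteq> nbhd E s"
    using vs(3)[of k] vs(3)[of pred] idx k mods by (simp add: nbhd_def insert_commute)
  moreover have "vs ! succ \<noteq> vs ! pred"
    using idx vs(1) by (simp add: n_def nth_eq_iff_index_eq)
  ultimately show ?thesis
    using card_mono[of "nbhd E s \<inter> (set vs - {s})" "{vs ! succ, vs ! pred}"] by simp
qed

lemma forest_insert:
  assumes "finite W" "forest W E" "card (nbhd E s \<inter> W) \<le> 1"
  shows "forest (insert s W) E"
  unfolding forest_def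
proof
  assume "\<exists>vs. is_cycle (insert s W) E vs"
  then obtain vs where cycle: "is_cycle (insert s W) E vs" by blast
  then have subset: "set vs - {s} \<subseteq> W" by (auto simp: is_cycle_def)
  show False
  proof (cases "s \<in> set vs")
    case True
    have "card (nbhd E s \<inter> (set vs - {s})) \<le> card (nbhd E s \<inter> W)"
      using subset \<open>finite W\<close> by (intro card_mono) auto
    then show False using is_cycle_card_nbhd[OF cycle True] assms(3) by simp
  next
    case False
    then have "is_cycle W E vs" using cycle subset by (simp add: is_cycle_def)
    then show False using \<open>forest W E\<close> by (auto simp: forest_def)
  qed
qed

subsection \<open>Equitable tree-colorings\<close>

lemma equitable_tree_coloring_iff:
  "equitable_tree_coloring V E t f \<longleftrightarrow>
     coloring V t f \<and> equitable V t f \<and> (\<forall>i\<in>{1..t}. forest (color_class V f i) E)"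
  by (simp add: equitable_tree_coloring_def forest_induced_edges_iff)

lemma equitable_tree_coloring_card_le:
  assumes "finite V" "card V \<le> t"
  shows "\<exists>f. equitable_tree_coloring V E t f"
proof -
  obtain f where f: "f ` V \<subseteq> {1..t}" "inj_on f V"
    using card_le_inj[of V "{1..t}"] assms by auto
  have finite: "finite (color_class V f i)" for i using assms(1) by (simp add: color_class_def)
  have class_le_1: "card (color_class V f i) \<le> 1" for i
    using f(2) by (auto simp: card_le_Suc0_iff_eq assms(1) color_class_def inj_on_def)
  have "\<bar>int (card (color_class V f i)) - int (card (color_class V f j))\<bar> \<le> 1" for i j
    using class_le_1[of i] class_le_1[of j] by linarith
  moreover have "forest (color_class V f i) E" for i
    using class_le_1[of i] by (intro card_le_2_imp_forest finite) simp
  ultimately have "equitable_tree_coloring V E t f"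
    using f(1) by (simp add: equitable_tree_coloring_iff coloring_def equitable_def)
  then show ?thesis by blast
qed

lemma equitable_tree_coloring_one_iff: "(\<exists>f. equitable_tree_coloring V E 1 f) \<longleftrightarrow> forest V E"
proof
  assume "\<exists>f. equitable_tree_coloring V E 1 f"
  then obtain f where f: "f ` V \<subseteq> {1}" "forest (color_class V f 1) E"
    by (auto simp: equitable_tree_coloring_iff coloring_def)
  then have "color_class V f 1 = V" by (auto simp: color_class_def)
  then show "forest V E" using f by simp
next
  assume "forest V E"
  moreover have "color_class V (\<lambda>_. 1) 1 = V" by (simp add: color_class_def)
  ultimately have "equitable_tree_coloring V E 1 (\<lambda>_. 1)"
    by (auto simp: equitable_tree_coloring_iff coloring_def equitable_def)
  then show "\<exists>f. equitable_tree_coloring V E 1 f" by blast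
qed

lemma finite_frequent_values:
  assumes "finite N" "0 < k"
  shows "finite {c. k \<le> card {u \<in> N. f u = c}}"
proof (rule finite_subset)
  show "{c. k \<le> card {u \<in> N. f u = c}} \<subseteq> f ` N"
  proof
    fix c assume "c \<in> {c. k \<le> card {u \<in> N. f u = c}}"
    then have "{u \<in> N. f u = c} \<noteq> {}" using \<open>0 < k\<close> by (intro notI) simp
    then show "c \<in> f ` N" by blast
  qed
qed (use \<open>finite N\<close> in simp)

lemma card_frequent_values:
  assumes "finite N"
  shows "k * card {c. k \<le> card {u \<in> N. f u = c}} \<le> card N"
proof (cases "k = 0")
  case False
  let ?C = "{c. k \<le> card {u \<in> N. f u = c}}"
  have "k * card ?C = (\<Sum>c\<in>?C. k)" by simp
  also have "\<dots> \<le> (\<Sum>c\<in>?C. card {u \<in> N. f u = c})" by (intro sum_mono) simp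
  also have "\<dots> = card (\<Union>c\<in>?C. {u \<in> N. f u = c})"
    using finite_frequent_values[OF assms] False assms by (intro card_UN_disjoint[symmetric]) auto
  also have "\<dots> \<le> card N" using assms by (intro card_mono) auto
  finally show ?thesis .
qed simp

lemma inj_on_avoiding:
  assumes "finite S" "card S < card C" "\<forall>s\<in>S. card (bad s \<inter> C) \<le> 1"
  shows "\<exists>b. inj_on b S \<and> b ` S \<subseteq> C \<and> (\<forall>s\<in>S. b s \<notin> bad s)"
  using assms
proof (induction S arbitrary: C)
  case empty
  then show ?case by simp
next
  case (insert s S)
  have "finite C" using insert.prems(1) by (simp add: card_ge_0_finite)
  have "card (bad s \<inter> C) < card C" using insert by force
  then obtain c where c: "c \<in> C" "c \<notin> bad s" by (metis Int_absorb1 nat_neq_iff subsetI)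
  have "card (bad z \<inter> (C - {c})) \<le> card (bad z \<inter> C)" for z
    using \<open>finite C\<close> by (intro card_mono) auto
  then have "\<forall>z\<in>S. card (bad z \<inter> (C - {c})) \<le> 1" using insert.prems(2) le_trans by blast
  moreover have "card S < card (C - {c})" using insert c(1) \<open>finite C\<close> by simp
  ultimately obtain b where b: "inj_on b S" "b ` S \<subseteq> C - {c}" "\<forall>z\<in>S. b z \<notin> bad z"
    using insert.IH by blast
  then have "inj_on (b(s := c)) (insert s S)" "b(s := c) ` insert s S \<subseteq> C"
      "\<forall>z\<in>insert s S. (b(s := c)) z \<notin> bad z"
    using c insert.hyps(2) by (auto simp: inj_on_def)
  then show ?case by blast
qed

lemma bij_betw_avoiding:
  assumes "finite S" "card S = card C" "x \<in> S" "bad x = {}" "\<forall>s\<in>S. card (bad s \<inter> C) \<le> 1"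
  shows "\<exists>b. bij_betw b S C \<and> (\<forall>s\<in>S. b s \<notin> bad s)"
proof -
  have "card S > 0" using assms(1,3) card_gt_0_iff by blast
  then have "finite C" "card (S - {x}) < card C" using assms(1-3) by (auto intro: card_ge_0_finite)
  then obtain b where b: "inj_on b (S - {x})" "b ` (S - {x}) \<subseteq> C" "\<forall>s\<in>S - {x}. b s \<notin> bad s"
    using inj_on_avoiding[of "S - {x}" C bad] assms by auto
  have "card (b ` (S - {x})) < card C"
    using card_image[OF b(1)] \<open>card (S - {x}) < card C\<close> by simp
  then obtain c where c: "c \<in> C" "c \<notin> b ` (S - {x})"
    by (metis nat_neq_iff subsetI subset_antisym b(2))
  have "inj_on (b(x := c)) S" "b(x := c) ` S \<subseteq> C"
    using b c by (auto simp: inj_on_def)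
  then have "bij_betw (b(x := c)) S C"
    using card_subset_eq[OF \<open>finite C\<close>] card_image assms(2) by (metis bij_betw_def)
  moreover have "\<forall>s\<in>S. (b(x := c)) s \<notin> bad s" using b(3) assms(4) by simp
  ultimately show ?thesis by blast
qed

lemma equitable_tree_coloring_extend:
  assumes "finite V" "S \<subseteq> V" and f: "equitable_tree_coloring (V - S) E t f"
    and b: "bij_betw b S {1..t}" "\<And>s. s \<in> S \<Longrightarrow> card {u \<in> nbhd E s \<inter> (V - S). f u = b s} \<le> 1"
  shows "equitable_tree_coloring V E t (\<lambda>v. if v \<in> S then b v else f v)"
proof -
  define g where "g v = (if v \<in> S then b v else f v)" for v
  let ?D = "color_class (V - S) f"
  have finite_D: "finite (?D i)" for i using \<open>finite V\<close> by (simp add: color_class_def)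
  have class_g: "\<exists>s\<in>S. b s = i \<and> s \<notin> ?D i \<and> color_class V g i = insert s (?D i)"
    if i: "i \<in> {1..t}" for i
  proof -
    have "i \<in> b ` S" using b(1) i by (simp add: bij_betw_def)
    then obtain s where s: "s \<in> S" "b s = i" by blast
    have "b v = i \<longleftrightarrow> v = s" if "v \<in> S" for v
      using b(1) s that by (auto simp: bij_betw_def inj_on_def)
    then have "color_class V g i = insert s (?D i)"
      using s(1) \<open>S \<subseteq> V\<close> by (auto simp: color_class_def g_def)
    then show ?thesis using s by (auto simp: color_class_def)
  qed
  then have card_g: "card (color_class V g i) = Suc (card (?D i))" if "i \<in> {1..t}" for i
    using that finite_D by fastforce
  have "coloring V t g"
    using f b(1) by (auto simp: equitable_tree_coloring_iff coloring_def g_def bij_betw_def)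
  moreover have "equitable V t g"
    using f by (simp add: equitable_tree_coloring_iff equitable_def card_g)
  moreover have "forest (color_class V g i) E" if i: "i \<in> {1..t}" for i
  proof -
    obtain s where s: "s \<in> S" "b s = i" "color_class V g i = insert s (?D i)"
      using class_g[OF i] by blast
    have "nbhd E s \<inter> ?D i = {u \<in> nbhd E s \<inter> (V - S). f u = b s}"
      using s(2) by (auto simp: color_class_def)
    moreover have "forest (?D i) E" using f i by (simp add: equitable_tree_coloring_iff)
    ultimately show ?thesis using forest_insert[OF finite_D] b(2)[OF s(1)] s(3) by simp
  qed
  ultimately show ?thesis by (simp add: equitable_tree_coloring_iff g_def[abs_def])
qed

definition removable :: "'a set \<Rightarrow> 'a set set \<Rightarrow> 'a set \<Rightarrow> bool" where
  "removable V E S \<longleftrightarrow> S \<subseteq> V \<and> (\<exists>x\<in>S. card (nbhd E x \<inter> (V - S)) \<le> 1) \<and>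
     (\<forall>s\<in>S. card (nbhd E s \<inter> (V - S)) \<le> 3)"

lemma equitable_tree_coloring_extend_removable:
  assumes "finite V" "removable V E S" and f: "equitable_tree_coloring (V - S) E (card S) f"
  shows "\<exists>g. equitable_tree_coloring V E (card S) g"
proof -
  obtain x where "S \<subseteq> V" and x: "x \<in> S" "card (nbhd E x \<inter> (V - S)) \<le> 1"
    and le_3: "\<And>s. s \<in> S \<Longrightarrow> card (nbhd E s \<inter> (V - S)) \<le> 3"
    using assms(2) unfolding removable_def by blast
  define bad where "bad s = {c. 2 \<le> card {u \<in> nbhd E s \<inter> (V - S). f u = c}}" for s
  have finite: "finite (nbhd E s \<inter> (V - S))" for s using \<open>finite V\<close> by simp
  have finite_bad: "finite (bad s)" for s
    unfolding bad_def using finite by (intro finite_frequent_values) auto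
  have card_bad: "2 * card (bad s) \<le> card (nbhd E s \<inter> (V - S))" for s
    unfolding bad_def using finite by (rule card_frequent_values)
  have "card (bad x) = 0" using card_bad[of x] x(2) by simp
  then have "bad x = {}" using finite_bad by simp
  moreover have "card (bad s \<inter> {1..card S}) \<le> 1" if "s \<in> S" for s
  proof -
    have "card (bad s \<inter> {1..card S}) \<le> card (bad s)" using finite_bad by (intro card_mono) auto
    then show ?thesis using card_bad[of s] le_3[OF that] by simp
  qed
  ultimately obtain b where b: "bij_betw b S {1..card S}" "\<forall>s\<in>S. b s \<notin> bad s"
    using bij_betw_avoiding[of S "{1..card S}" x bad] finite_subset[OF \<open>S \<subseteq> V\<close> \<open>finite V\<close>] x(1)
    by auto
  then have "card {u \<in> nbhd E s \<inter> (V - S). f u = b s} \<le> 1" if "s \<in> S" for s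
    using that by (fastforce simp: bad_def)
  then show ?thesis using equitable_tree_coloring_extend[OF \<open>finite V\<close> \<open>S \<subseteq> V\<close> f b(1)] by blast
qed

lemma hereditarily_light_subset: "hereditarily_light V E \<Longrightarrow> W \<subseteq> V \<Longrightarrow> hereditarily_light W E"
  by (auto simp: hereditarily_light_def)

lemma nbhd_induced_edges: "x \<in> W \<Longrightarrow> nbhd (induced_edges E W) x = nbhd E x \<inter> W"
  by (auto simp: nbhd_def induced_edges_def)

lemma hereditarily_lightE:
  assumes "hereditarily_light V E" "W \<subseteq> V" "W \<noteq> {}"
  obtains x where "x \<in> W" "card (nbhd E x \<inter> W) \<le> 1"
  | x y where "x \<in> W" "y \<in> W" "x \<in> nbhd E y" "y \<in> nbhd E x"
    "card (nbhd E x \<inter> W) = 2" "card (nbhd E y \<inter> W) \<le> 4"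
proof -
  let ?N = "nbhd (induced_edges E W)"
  have "has_light_vertex W (induced_edges E W)"
    using assms by (simp add: hereditarily_light_def)
  then consider x where "x \<in> W" "card (?N x) \<le> 1"
    | x y where "x \<in> W" "card (?N x) = 2" "y \<in> ?N x" "card (?N y) \<le> 4"
    unfolding has_light_vertex_def by blast
  then show thesis
  proof cases
    fix x assume "x \<in> W" "card (?N x) \<le> 1"
    then show thesis using that(1)[of x] by (simp add: nbhd_induced_edges)
  next
    fix x y assume xy: "x \<in> W" "card (?N x) = 2" "y \<in> ?N x" "card (?N y) \<le> 4"
    then have "y \<in> nbhd E x" "y \<in> W" by (simp_all add: nbhd_induced_edges)
    then show thesis
      using that(2)[of x y] xy nbhd_commute[of y E x] by (simp add: nbhd_induced_edges)
  qed
qed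

lemma hereditarily_light_peel:
  assumes "finite V" "hereditarily_light V E" "U \<subseteq> V" "card U + k \<le> card V"
  shows "\<exists>S. U \<subseteq> S \<and> S \<subseteq> V \<and> card S = card U + k \<and> (\<forall>s\<in>S - U. card (nbhd E s \<inter> (V - S)) \<le> 2)"
  using assms(4)
proof (induction k)
  case 0
  then show ?case using \<open>U \<subseteq> V\<close> by auto
next
  case (Suc k)
  then obtain S where S: "U \<subseteq> S" "S \<subseteq> V" "card S = card U + k"
    "\<forall>s\<in>S - U. card (nbhd E s \<inter> (V - S)) \<le> 2"
    by auto
  have "V - S \<noteq> {}" using S Suc.prems by auto
  then obtain x where x: "x \<in> V - S" "card (nbhd E x \<inter> (V - S)) \<le> 2"
    using hereditarily_lightE[OF assms(2) Diff_subset \<open>V - S \<noteq> {}\<close>]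
    by (metis le_trans one_le_numeral order_refl)
  have mono: "card (nbhd E s \<inter> (V - insert x S)) \<le> card (nbhd E s \<inter> (V - S))" for s
    using \<open>finite V\<close> by (intro card_mono) auto
  have "\<forall>s\<in>insert x S - U. card (nbhd E s \<inter> (V - S)) \<le> 2" using S(4) x(2) by auto
  then have "\<forall>s\<in>insert x S - U. card (nbhd E s \<inter> (V - insert x S)) \<le> 2"
    using mono le_trans by blast
  moreover have "card (insert x S) = card U + Suc k"
    using x(1) S(2,3) finite_subset[OF S(2) \<open>finite V\<close>] by simp
  ultimately show ?case using S(1,2) x(1) by (intro exI[of _ "insert x S"]) auto
qed

lemma hereditarily_light_small_removable:
  assumes "finite V" "hereditarily_light V E" "V \<noteq> {}"
  shows "\<exists>U. removable V E U \<and> card U \<le> 2"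
  using hereditarily_lightE[OF assms(2) subset_refl assms(3)]
proof cases
  fix x assume x: "x \<in> V" "card (nbhd E x \<inter> V) \<le> 1"
  have "card (nbhd E x \<inter> (V - {x})) \<le> card (nbhd E x \<inter> V)"
    using \<open>finite V\<close> by (intro card_mono) auto
  then show ?thesis using x by (intro exI[of _ "{x}"]) (auto simp: removable_def)
next
  fix x y assume xy: "x \<in> V" "y \<in> V" "x \<in> nbhd E y" "y \<in> nbhd E x"
    "card (nbhd E x \<inter> V) = 2" "card (nbhd E y \<inter> V) \<le> 4"
  have "card (nbhd E x \<inter> (V - {x, y})) \<le> card (nbhd E x \<inter> V - {y})"
    "card (nbhd E y \<inter> (V - {x, y})) \<le> card (nbhd E y \<inter> V - {x})"
    using \<open>finite V\<close> by (intro card_mono; auto)+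
  then have "card (nbhd E x \<inter> (V - {x, y})) \<le> 1" "card (nbhd E y \<inter> (V - {x, y})) \<le> 3"
    using xy \<open>finite V\<close> by auto
  moreover have "card {x, y} \<le> 2" by (simp add: card_insert_if)
  ultimately show ?thesis using xy(1,2) by (intro exI[of _ "{x, y}"]) (auto simp: removable_def)
qed

lemma hereditarily_light_removable:
  assumes "finite V" "hereditarily_light V E" "2 \<le> t" "t \<le> card V"
  shows "\<exists>S. removable V E S \<and> card S = t"
proof -
  have "V \<noteq> {}" using assms(3,4) by auto
  then obtain U x where U: "U \<subseteq> V" "card U \<le> 2" "\<forall>s\<in>U. card (nbhd E s \<inter> (V - U)) \<le> 3"
    and x: "x \<in> U" "card (nbhd E x \<inter> (V - U)) \<le> 1"
    using hereditarily_light_small_removable[OF assms(1,2)] unfolding removable_def by blast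
  have "card U + (t - card U) = t" using U(2) assms(3) by simp
  then obtain S where S: "U \<subseteq> S" "S \<subseteq> V" "card S = t" "\<forall>s\<in>S - U. card (nbhd E s \<inter> (V - S)) \<le> 2"
    using hereditarily_light_peel[OF assms(1,2) U(1), of "t - card U"] assms(4) by auto
  have mono: "card (nbhd E s \<inter> (V - S)) \<le> card (nbhd E s \<inter> (V - U))" for s
    using \<open>finite V\<close> S(1) by (intro card_mono) auto
  have "card (nbhd E s \<inter> (V - S)) \<le> 3" if "s \<in> S" for s
  proof (cases "s \<in> U")
    case True
    then show ?thesis using U(3) mono[of s] le_trans by blast
  next
    case False
    then have "card (nbhd E s \<inter> (V - S)) \<le> 2" using that S(4) by blast
    then show ?thesis by simp
  qed
  moreover have "card (nbhd E x \<inter> (V - S)) \<le> 1" using mono[of x] x(2) by simp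
  ultimately show ?thesis using S(1-3) x(1) unfolding removable_def by blast
qed

lemma hereditarily_light_equitable_tree_coloring:
  assumes "finite V" "hereditarily_light V E" "2 \<le> t"
  shows "\<exists>f. equitable_tree_coloring V E t f"
  using assms(1,2)
proof (induction V rule: finite_psubset_induct)
  case (psubset V)
  show ?case
  proof (cases "card V \<le> t")
    case True
    then show ?thesis using equitable_tree_coloring_card_le psubset.hyps by blast
  next
    case False
    then obtain S where S: "removable V E S" "card S = t"
      using hereditarily_light_removable[OF psubset.hyps psubset.prems \<open>2 \<le> t\<close>]
      by (meson nat_le_linear)
    then have "V - S \<subset> V" by (auto simp: removable_def)
    then obtain f where "equitable_tree_coloring (V - S) E (card S) f"
      using psubset.IH hereditarily_light_subset[OF psubset.prems] S(2) by blast
    then show ?thesis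
      using equitable_tree_coloring_extend_removable[OF psubset.hyps S(1)] S(2) by simp
  qed
qed

lemma va_equiv_eq:
  assumes "\<forall>t\<ge>2. \<exists>f. equitable_tree_coloring V E t f"
  shows "va_equiv V E = (if forest V E then 1 else 2)"
  unfolding va_equiv_def
proof (rule Least_equality)
  let ?m = "if forest V E then 1 else (2::nat)"
  have "1 \<le> t \<and> t \<noteq> 1 \<longleftrightarrow> 2 \<le> t" for t :: nat by auto
  then show "1 \<le> ?m \<and> (\<forall>t\<ge>?m. \<exists>f. equitable_tree_coloring V E t f)"
    using assms equitable_tree_coloring_one_iff[of V E] by (metis one_le_numeral order_refl)
  fix t :: nat assume t: "1 \<le> t \<and> (\<forall>t'\<ge>t. \<exists>f. equitable_tree_coloring V E t' f)"
  show "?m \<le> t"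
  proof (cases "t = 1")
    case True
    then show ?thesis using t equitable_tree_coloring_one_iff[of V E] by simp
  qed (use t in auto)
qed

theorem theorem3p10:
  fixes V :: "'a set" and E :: "'a set set"
  assumes "simple_graph V E" and "outerplanar V E"
  shows "(\<forall>t\<ge>2. \<exists>f. equitable_tree_coloring V E t f) \<and>
         va_equiv V E = (if forest V E then 1 else 2)"
proof
  have "finite V" using assms(1) by (simp add: simple_graph_def)
  moreover have "hereditarily_light V E"
    using subdivision_free_hereditarily_light[OF assms(1) outerplanar_subdivision_free[OF assms]] .
  ultimately show "\<forall>t\<ge>2. \<exists>f. equitable_tree_coloring V E t f"
    using hereditarily_light_equitable_tree_coloring by blast
  then show "va_equiv V E = (if forest V E then 1 else 2)" by (rule va_equiv_eq)
qed

end
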